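(* Let $k,n$ be natural numbers with $1<k<n$. Then the graph of pyramids $T_{n,k} = K_k\vee\overline{K_{n-k}}$ is determined by its adjacency spectrum; that is, every graph whose adjacency matrix has the same multiset of eigenvalues as that of $T_{n,k}$ is isomorphic to $T_{n,k}$.
   Context: All graphs are finite, simple and undirected. $K_m$ is the complete graph on $m$ vertices, $\overline{K_m}$ the empty graph on $m$ vertices, and $G\vee H$ denotes the join (disjoint union together with all edges between $V(G)$ and $V(H)$). For $k>1$, $T_{n,k}$ is called a graph of pyramids. *)

theory Defs
  imports
    "Graph_Theory.Pair_Digraph"
    "Graph_Theory.Digraph_Isomorphism"
    "Graph_Theory.Kuratowski"
    "Jordan_Normal_Form.Char_Poly"
    "HOL-Computational_Algebra.Polynomial"
begin

text \<open>
  Finite simple undirected graphs are the symmetric digraphs of the locale \<^locale>\<open>graph\<close>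
  (finite, no loops, no parallel arcs): each edge is a pair of opposite arcs.
\<close>

definition complete_graph :: "nat \<Rightarrow> nat pair_pre_digraph" where
  "complete_graph m = \<lparr> pverts = {..<m}, parcs = {(u, v). u < m \<and> v < m \<and> u \<noteq> v} \<rparr>"

definition empty_graph :: "nat \<Rightarrow> nat pair_pre_digraph" where
  "empty_graph m = \<lparr> pverts = {..<m}, parcs = {} \<rparr>"

definition graph_join ::
    "'a pair_pre_digraph \<Rightarrow> 'b pair_pre_digraph \<Rightarrow> ('a + 'b) pair_pre_digraph" where
  "graph_join G H = \<lparr>
     pverts = pverts G <+> pverts H,
     parcs = map_prod Inl Inl ` parcs G \<union> map_prod Inr Inr ` parcs H
       \<union> (Inl ` pverts G) \<times> (Inr ` pverts H) \<union> (Inr ` pverts H) \<times> (Inl ` pverts G) \<rparr>"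

definition pyramid_graph :: "nat \<Rightarrow> nat \<Rightarrow> (nat + nat) pair_pre_digraph" where
  "pyramid_graph n k = graph_join (complete_graph k) (empty_graph (n - k))"

definition vertex_enum :: "('a, 'b) pre_digraph \<Rightarrow> 'a list \<Rightarrow> bool" where
  "vertex_enum G vs \<longleftrightarrow> distinct vs \<and> set vs = verts G"

definition adjacency_matrix :: "('a, 'b) pre_digraph \<Rightarrow> 'a list \<Rightarrow> complex mat" where
  "adjacency_matrix G vs =
     mat (length vs) (length vs) (\<lambda>(i, j). if (vs ! i, vs ! j) \<in> arcs_ends G then 1 else 0)"

text \<open>
  The eigenvalues with their algebraic multiplicities. The matrix is taken over the complex
  numbers, so that the multiset is complete without appeal to the spectral theorem. The choice of
  the vertex enumeration is immaterial, see \<open>adjacency_spectrum_eq\<close> below.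
\<close>

definition adjacency_spectrum :: "('a, 'b) pre_digraph \<Rightarrow> complex multiset" where
  "adjacency_spectrum G = proots (char_poly (adjacency_matrix G (SOME vs. vertex_enum G vs)))"

lemma similar_adjacency_matrix:
  assumes "vertex_enum G vs" "vertex_enum G ws"
  shows "similar_mat (adjacency_matrix G vs) (adjacency_matrix G ws)"
proof -
  define n where "n = length vs"
  have dv: "distinct vs" "distinct ws" and s: "set vs = set ws"
    using assms by (auto simp: vertex_enum_def)
  then have n': "length ws = n"
    unfolding n_def by (metis distinct_card)
  define P :: "complex mat" where "P = mat n n (\<lambda>(i, j). if vs ! i = ws ! j then 1 else 0)"
  define Q :: "complex mat" where "Q = mat n n (\<lambda>(i, j). if ws ! i = vs ! j then 1 else 0)"
  have ex: "\<exists>l<n. ws ! l = vs ! i" if "i < n" for i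
    using that s n' n_def by (metis in_set_conv_nth nth_mem)
  have ex': "\<exists>l<n. vs ! l = ws ! i" if "i < n" for i
    using that s n' n_def by (metis in_set_conv_nth nth_mem)
  have eqv: "vs ! i = vs ! j \<longleftrightarrow> i = j" if "i < n" "j < n" for i j
    using that dv n_def by (simp add: nth_eq_iff_index_eq)
  have eqw: "ws ! i = ws ! j \<longleftrightarrow> i = j" if "i < n" "j < n" for i j
    using that dv n' by (simp add: nth_eq_iff_index_eq)
  have sumv: "(\<Sum>l = 0..<n. (if vs ! l = x then 1 else 0) * f l) = f m"
    "(\<Sum>l = 0..<n. f l * (if vs ! l = x then 1 else 0)) = f m"
    "(\<Sum>l = 0..<n. (if x = vs ! l then 1 else 0) * f l) = f m"
    "(\<Sum>l = 0..<n. f l * (if x = vs ! l then 1 else 0)) = f m"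
    if "m < n" "x = vs ! m" for x m and f :: "nat \<Rightarrow> complex"
  proof -
    have *: "vs ! l = x \<longleftrightarrow> l = m" "x = vs ! l \<longleftrightarrow> l = m" if "l \<in> {0..<n}" for l
      using \<open>m < n\<close> \<open>x = vs ! m\<close> that eqv[of l m] by auto
    have **: "(\<Sum>l = 0..<n. if l = m then f l else 0) = f m"
      using \<open>m < n\<close> by simp
    show "(\<Sum>l = 0..<n. (if vs ! l = x then 1 else 0) * f l) = f m"
      "(\<Sum>l = 0..<n. f l * (if vs ! l = x then 1 else 0)) = f m"
      "(\<Sum>l = 0..<n. (if x = vs ! l then 1 else 0) * f l) = f m"
      "(\<Sum>l = 0..<n. f l * (if x = vs ! l then 1 else 0)) = f m"
      by (subst **[symmetric], rule sum.cong[OF refl], simp add: *)+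
  qed
  have sumw: "(\<Sum>l = 0..<n. (if ws ! l = x then 1 else 0) * f l) = f m"
    "(\<Sum>l = 0..<n. f l * (if ws ! l = x then 1 else 0)) = f m"
    "(\<Sum>l = 0..<n. (if x = ws ! l then 1 else 0) * f l) = f m"
    "(\<Sum>l = 0..<n. f l * (if x = ws ! l then 1 else 0)) = f m"
    if "m < n" "x = ws ! m" for x m and f :: "nat \<Rightarrow> complex"
  proof -
    have *: "ws ! l = x \<longleftrightarrow> l = m" "x = ws ! l \<longleftrightarrow> l = m" if "l \<in> {0..<n}" for l
      using \<open>m < n\<close> \<open>x = ws ! m\<close> that eqw[of l m] by auto
    have **: "(\<Sum>l = 0..<n. if l = m then f l else 0) = f m"
      using \<open>m < n\<close> by simp
    show "(\<Sum>l = 0..<n. (if ws ! l = x then 1 else 0) * f l) = f m"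
      "(\<Sum>l = 0..<n. f l * (if ws ! l = x then 1 else 0)) = f m"
      "(\<Sum>l = 0..<n. (if x = ws ! l then 1 else 0) * f l) = f m"
      "(\<Sum>l = 0..<n. f l * (if x = ws ! l then 1 else 0)) = f m"
      by (subst **[symmetric], rule sum.cong[OF refl], simp add: *)+
  qed
  have PQ: "P * Q = 1\<^sub>m n"
  proof (rule eq_matI)
    fix i j assume ij: "i < dim_row (1\<^sub>m n :: complex mat)" "j < dim_col (1\<^sub>m n :: complex mat)"
    then obtain m where m: "m < n" "vs ! i = ws ! m" using ex[of i] by auto
    have "(P * Q) $$ (i, j) = (if ws ! m = vs ! j then 1 else 0)"
      using ij m by (simp add: P_def Q_def scalar_prod_def sumw)
    then show "(P * Q) $$ (i, j) = 1\<^sub>m n $$ (i, j)"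
      using ij m(2)[symmetric] eqv by auto
  qed (auto simp: P_def Q_def)
  have QP: "Q * P = 1\<^sub>m n"
  proof (rule eq_matI)
    fix i j assume ij: "i < dim_row (1\<^sub>m n :: complex mat)" "j < dim_col (1\<^sub>m n :: complex mat)"
    then obtain m where m: "m < n" "ws ! i = vs ! m" using ex'[of i] by auto
    have "(Q * P) $$ (i, j) = (if vs ! m = ws ! j then 1 else 0)"
      using ij m by (simp add: P_def Q_def scalar_prod_def sumv)
    then show "(Q * P) $$ (i, j) = 1\<^sub>m n $$ (i, j)"
      using ij m(2)[symmetric] eqw by auto
  qed (auto simp: P_def Q_def)
  have A: "adjacency_matrix G vs = P * adjacency_matrix G ws * Q"
  proof (rule eq_matI)
    fix i j
    assume "i < dim_row (P * adjacency_matrix G ws * Q)" "j < dim_col (P * adjacency_matrix G ws * Q)"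
    then have ij: "i < n" "j < n" by (auto simp: P_def Q_def)
    obtain a where a: "a < n" "vs ! i = ws ! a" using ex[OF ij(1)] by auto
    obtain b where b: "b < n" "vs ! j = ws ! b" using ex[OF ij(2)] by auto
    have row: "(P * adjacency_matrix G ws) $$ (i, l) = adjacency_matrix G ws $$ (a, l)" if "l < n" for l
      using ij that a n' by (simp add: P_def adjacency_matrix_def scalar_prod_def sumw)
    have "(P * adjacency_matrix G ws * Q) $$ (i, j)
        = (\<Sum>l = 0..<n. (P * adjacency_matrix G ws) $$ (i, l) * Q $$ (l, j))"
      using ij n' by (simp add: P_def Q_def adjacency_matrix_def scalar_prod_def)
    also have "\<dots> = (\<Sum>l = 0..<n. adjacency_matrix G ws $$ (a, l) * (if ws ! l = vs ! j then 1 else 0))"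
      by (rule sum.cong) (use ij in \<open>simp_all add: row Q_def\<close>)
    also have "\<dots> = adjacency_matrix G ws $$ (a, b)"
      using b by (simp only: sumw)
    finally show "adjacency_matrix G vs $$ (i, j) = (P * adjacency_matrix G ws * Q) $$ (i, j)"
      using ij a b n' by (simp add: adjacency_matrix_def n_def)
  qed (auto simp: P_def Q_def adjacency_matrix_def n_def)
  have "similar_mat_wit (adjacency_matrix G vs) (adjacency_matrix G ws) P Q"
    unfolding similar_mat_wit_def using PQ QP A n'
    by (auto simp: Let_def adjacency_matrix_def n_def P_def Q_def)
  then show ?thesis
    unfolding similar_mat_def by blast
qed

lemma adjacency_spectrum_eq:
  assumes "vertex_enum G vs"
  shows "adjacency_spectrum G = proots (char_poly (adjacency_matrix G vs))"
  unfolding adjacency_spectrum_def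
  by (metis (full_types) assms char_poly_similar similar_adjacency_matrix someI_ex)

lemma pair_graph_pyramid_graph: "pair_graph (pyramid_graph n k)"
  by unfold_locales
    (auto simp: pyramid_graph_def graph_join_def complete_graph_def empty_graph_def
       symmetric_def sym_def intro: finite_subset[of _ "{..<k} \<times> {..<k}"])

lemma complete_graph_complete_digraph: "complete_digraph m (with_proj (complete_graph m))"
  unfolding complete_digraph_pair_def by (auto simp: complete_graph_def)

end

theory Submission
  imports Defs "Jordan_Normal_Form.Schur_Decomposition"
begin

text \<open>
  The pyramid graph has at most one positive eigenvalue and at most one eigenvalue below $-1$.
  In terms of quadratic forms each of these conditions is a reverse Cauchy--Schwarz inequality, and
  testing it on vectors of small support excludes configurations in any cospectral graph \<open>G\<close>.
  The first one makes non-adjacency transitive on the non-isolated vertices, so that \<open>G\<close> is complete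
  multipartite up to isolated vertices; the second one, together with the eigenvalue $-1$ (available
  since $k > 1$), leaves at most one part with more than one vertex. Hence \<open>G\<close> is a complete split
  graph with $c$ dominating and $m$ independent vertices plus isolated ones, and its eigenvalues
  other than $0$ and $-1$ are roots of $x^2 - (c - 1) x - c m$. Comparing with
  $x^2 - (k - 1) x - k (n - k)$ gives $c = k$ and $m = n - k$.
\<close>

section \<open>Unitary diagonalization of Hermitian matrices\<close>

definition ctrans :: "complex mat \<Rightarrow> complex mat" where
  "ctrans A = mat (dim_col A) (dim_row A) (\<lambda>(i, j). cnj (A $$ (j, i)))"

lemma ctrans_dim [simp]: "dim_row (ctrans A) = dim_col A" "dim_col (ctrans A) = dim_row A"
  by (auto simp: ctrans_def)

lemma ctrans_index [simp]:
  "i < dim_col A \<Longrightarrow> j < dim_row A \<Longrightarrow> ctrans A $$ (i, j) = cnj (A $$ (j, i))"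
  by (simp add: ctrans_def)

lemma ctrans_carrier [simp]: "A \<in> carrier_mat n m \<Longrightarrow> ctrans A \<in> carrier_mat m n"
  by (auto simp: ctrans_def)

lemma ctrans_ctrans [simp]: "ctrans (ctrans A) = A"
  by (rule eq_matI) auto

lemma ctrans_mult:
  assumes "A \<in> carrier_mat n m" "B \<in> carrier_mat m p"
  shows "ctrans (A * B) = ctrans B * ctrans A"
  using assms by (intro eq_matI) (auto simp: scalar_prod_def mult.commute)

lemma ctrans_four_block:
  assumes "A \<in> carrier_mat n1 m1" "B \<in> carrier_mat n1 m2" "C \<in> carrier_mat n2 m1" "D \<in> carrier_mat n2 m2"
  shows "ctrans (four_block_mat A B C D) = four_block_mat (ctrans A) (ctrans C) (ctrans B) (ctrans D)"
  using assms by (intro eq_matI) auto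

text \<open>Complete \<open>v\<close> to a basis, orthogonalize by Gram-Schmidt, which keeps the
  first vector, and divide each vector by its norm. Only the direction of the first column matters,
  hence the unspecified \<open>c\<close>.\<close>

lemma unitary_extension:
  fixes v :: "complex vec"
  assumes v: "v \<in> carrier_vec n" and v0: "v \<noteq> 0\<^sub>v n"
  obtains W c where "W \<in> carrier_mat n n" "ctrans W * W = 1\<^sub>m n" "col W 0 = c \<cdot>\<^sub>v v"
proof -
  interpret cof_vec_space n "TYPE(complex)" .
  have n: "n > 0" using v v0 by (cases n) auto
  define ws where "ws = gram_schmidt n (basis_completion v)"
  note b = basis_completion[OF v v0]
  have ws: "set ws \<subseteq> carrier_vec n" "corthogonal ws" "length ws = n"
    using gram_schmidt_result[OF b(2,4,5) ws_def] b(6) by auto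
  from b(6,7) n obtain vs where bv: "basis_completion v = v # vs"
    by (cases "basis_completion v") auto
  have hd: "ws ! 0 = v"
    using gram_schmidt_hd[OF v, of vs] ws n unfolding ws_def bv
    by (metis hd_conv_nth length_greater_0_conv)
  have wsc: "ws ! j \<in> carrier_vec n" if "j < n" for j using ws that by auto
  define r where "r j = complex_of_real (sqrt (\<Sum>i<n. (cmod (ws ! j $ i))\<^sup>2))" for j
  have ip: "(\<Sum>l<n. cnj (ws ! i $ l) * ws ! j $ l) = ws ! j \<bullet>c ws ! i" if "i < n" "j < n" for i j
    using wsc[OF that(1)] wsc[OF that(2)]
    by (simp add: scalar_prod_def mult.commute lessThan_atLeast0)
  have rsq: "cnj (r j) * r j = (\<Sum>l<n. cnj (ws ! j $ l) * ws ! j $ l)" for j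
  proof -
    have "cnj (r j) * r j = complex_of_real ((sqrt (\<Sum>i<n. (cmod (ws ! j $ i))\<^sup>2))\<^sup>2)"
      unfolding r_def by (simp only: complex_cnj_complex_of_real of_real_mult[symmetric] power2_eq_square)
    also have "\<dots> = of_real (\<Sum>i<n. (cmod (ws ! j $ i))\<^sup>2)"
      by (simp add: sum_nonneg)
    also have "\<dots> = (\<Sum>l<n. cnj (ws ! j $ l) * ws ! j $ l)"
      by (simp add: complex_norm_square[symmetric] mult.commute)
    finally show ?thesis .
  qed
  have r0: "r j \<noteq> 0" if "j < n" for j
    using rsq[of j] ip[OF that that] corthogonalD[OF ws(2), of j j] that ws(3) by auto
  define W where "W = mat n n (\<lambda>(i, j). ws ! j $ i / r j)"
  have W: "W \<in> carrier_mat n n" by (simp add: W_def)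
  have "ctrans W * W = 1\<^sub>m n"
  proof (rule eq_matI)
    fix i j assume "i < dim_row (1\<^sub>m n :: complex mat)" "j < dim_col (1\<^sub>m n :: complex mat)"
    then have ij: "i < n" "j < n" by auto
    have "(ctrans W * W) $$ (i, j) = (\<Sum>l<n. cnj (ws ! i $ l) * ws ! j $ l) / (cnj (r i) * r j)"
      using ij by (simp add: W_def scalar_prod_def lessThan_atLeast0 sum_divide_distrib)
    also have "\<dots> = (if i = j then 1 else 0)"
      using ip[OF ij] rsq[of j] r0 ij corthogonalD[OF ws(2), of j i] ws(3) by auto
    finally show "(ctrans W * W) $$ (i, j) = 1\<^sub>m n $$ (i, j)" using ij by simp
  qed (auto simp: W_def)
  moreover have "col W 0 = (1 / r 0) \<cdot>\<^sub>v v"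
    using v n hd by (intro eq_vecI) (auto simp: W_def)
  ultimately show ?thesis using W that by blast
qed

definition diag_of :: "nat \<Rightarrow> (nat \<Rightarrow> complex) \<Rightarrow> complex mat" where
  "diag_of n d = mat n n (\<lambda>(i, j). if i = j then d i else 0)"

text \<open>Induction by deflation: in an orthonormal basis that starts with an eigenvector, a
  Hermitian matrix splits into a scalar block and a smaller Hermitian block. The equation
  \<open>A * U = U * diag_of n d\<close> says that the columns of \<open>U\<close> are
  eigenvectors.\<close>

lemma hermitian_unitary_diagonalization:
  assumes "A \<in> carrier_mat n n" "ctrans A = A"
  shows "\<exists>U d. U \<in> carrier_mat n n \<and> ctrans U * U = 1\<^sub>m n \<and> A * U = U * diag_of n d"
  using assms
proof (induction n arbitrary: A)
  case 0
  show ?case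
    by (rule exI[of _ "1\<^sub>m 0"]) (use 0 in \<open>auto simp: diag_of_def intro!: eq_matI\<close>)
next
  case (Suc n A)
  note A = Suc.prems(1)
  have "degree (char_poly A) \<noteq> 0" using degree_monic_char_poly[OF A] by simp
  then obtain e where "poly (char_poly A) e = 0"
    using fundamental_theorem_of_algebra[of "char_poly A"] by (auto simp: constant_degree)
  then have "eigenvalue A e" using eigenvalue_root_char_poly[OF A] by simp
  then obtain v where v: "v \<in> carrier_vec (Suc n)" "v \<noteq> 0\<^sub>v (Suc n)" "A *\<^sub>v v = e \<cdot>\<^sub>v v"
    using A unfolding eigenvalue_def eigenvector_def by auto
  obtain W c where W: "W \<in> carrier_mat (Suc n) (Suc n)" "ctrans W * W = 1\<^sub>m (Suc n)"
    and col: "col W 0 = c \<cdot>\<^sub>v v"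
    using unitary_extension[OF v(1,2)] .
  have cW: "ctrans W \<in> carrier_mat (Suc n) (Suc n)" using W by simp
  have WW: "W * ctrans W = 1\<^sub>m (Suc n)"
    using mat_mult_left_right_inverse[OF cW W(1) W(2)] .
  define A' where "A' = ctrans W * (A * W)"
  have A': "A' \<in> carrier_mat (Suc n) (Suc n)"
    unfolding A'_def by (intro mult_carrier_mat[of _ _ "Suc n"] cW A W(1))
  have hA': "ctrans A' = A'"
    unfolding A'_def using W(1) cW A Suc.prems(2)
    by (simp add: ctrans_mult[of _ "Suc n" "Suc n" _ "Suc n"] assoc_mult_mat[of _ "Suc n" "Suc n" _ "Suc n" _ "Suc n"])
  have "col (A * W) 0 = A *\<^sub>v col W 0" by (rule col_mult2[OF A W(1)]) simp
  also have "\<dots> = c \<cdot>\<^sub>v (A *\<^sub>v v)" unfolding col by (rule mult_mat_vec[OF A v(1)])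
  also have "\<dots> = e \<cdot>\<^sub>v col W 0" unfolding v(3) col by (simp add: smult_smult_assoc mult.commute)
  finally have AW: "col (A * W) 0 = e \<cdot>\<^sub>v col W 0" .
  have cW0: "col W 0 \<in> carrier_vec (Suc n)" unfolding col using v(1) by simp
  have "col A' 0 = ctrans W *\<^sub>v col (A * W) 0"
    unfolding A'_def by (rule col_mult2[OF cW mult_carrier_mat[OF A W(1)]]) simp
  also have "\<dots> = e \<cdot>\<^sub>v (ctrans W *\<^sub>v col W 0)" unfolding AW by (rule mult_mat_vec[OF cW cW0])
  also have "ctrans W *\<^sub>v col W 0 = col (1\<^sub>m (Suc n)) 0"
    by (metis W(2) cW W(1) col_mult2 zero_less_Suc)
  finally have cA': "col A' 0 = e \<cdot>\<^sub>v col (1\<^sub>m (Suc n)) 0" .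
  have col0: "A' $$ (i, 0) = (if i = 0 then e else 0)" if "i < Suc n" for i
    using arg_cong[OF cA', of "\<lambda>v. v $ i"] that A' by (auto split: if_splits)
  \<comment> \<open>Hermitian symmetry carries the zeros of the first column over to the first row,
    and the diagonal entry forces \<open>e\<close> to be real.\<close>
  have row0: "A' $$ (0, j) = (if j = 0 then e else 0)" if "j < Suc n" for j
  proof -
    have "A' $$ (0, j) = cnj (A' $$ (j, 0))"
      by (metis A' carrier_matD ctrans_index hA' that zero_less_Suc)
    moreover have "e = cnj e"
      by (metis A' carrier_matD ctrans_index hA' col0 zero_less_Suc)
    ultimately show ?thesis using col0[OF that] by auto
  qed
  define A3 where "A3 = mat n n (\<lambda>(i, j). A' $$ (Suc i, Suc j))"
  have A3: "A3 \<in> carrier_mat n n" by (simp add: A3_def)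
  have "ctrans A3 = A3"
  proof (rule eq_matI)
    fix i j assume "i < dim_row A3" "j < dim_col A3"
    then show "ctrans A3 $$ (i, j) = A3 $$ (i, j)"
      using A' hA' by (metis (no_types, lifting) A3_def Suc_less_eq carrier_matD ctrans_index dim_col_mat(1)
          dim_row_mat(1) index_mat(1) split_conv)
  qed (auto simp: A3_def)
  from Suc.IH[OF A3 this] obtain U d where U: "U \<in> carrier_mat n n" "ctrans U * U = 1\<^sub>m n"
    and AU: "A3 * U = U * diag_of n d" by blast
  \<comment> \<open>\<open>F\<close> extends the diagonalizing matrix of the lower block by the
    identity on the first coordinate; \<open>W * F\<close> is the matrix sought.\<close>
  define F where "F = four_block_mat (1\<^sub>m 1) (0\<^sub>m 1 n) (0\<^sub>m n 1) U"
  define d' where "d' = (\<lambda>i. if i = 0 then e else d (i - 1))"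
  have A'b: "A' = four_block_mat (diag_of 1 (\<lambda>_. e)) (0\<^sub>m 1 n) (0\<^sub>m n 1) A3"
    using A' col0 row0 by (intro eq_matI) (auto simp: A3_def diag_of_def)
  have Db: "diag_of (Suc n) d' = four_block_mat (diag_of 1 (\<lambda>_. e)) (0\<^sub>m 1 n) (0\<^sub>m n 1) (diag_of n d)"
    by (intro eq_matI) (auto simp: diag_of_def d'_def)
  have D1: "diag_of 1 (\<lambda>_. e) \<in> carrier_mat 1 1" "diag_of n d \<in> carrier_mat n n" by (auto simp: diag_of_def)
  have F: "F \<in> carrier_mat (Suc n) (Suc n)" using U unfolding F_def by auto
  have c1: "ctrans (1\<^sub>m 1) = 1\<^sub>m 1" "ctrans (0\<^sub>m 1 n) = 0\<^sub>m n 1" "ctrans (0\<^sub>m n 1) = 0\<^sub>m 1 n"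
    by (auto intro!: eq_matI)
  have FF: "ctrans F * F = 1\<^sub>m (Suc n)"
  proof -
    have "ctrans F = four_block_mat (1\<^sub>m 1) (0\<^sub>m 1 n) (0\<^sub>m n 1) (ctrans U)"
      unfolding F_def using U by (subst ctrans_four_block[of _ 1 1 _ n _ n]) (auto simp: c1)
    then show ?thesis unfolding F_def using U
      by (simp add: mult_four_block_mat[of _ 1 1 _ n _ n _ _ 1 _ n] four_block_one_mat)
  qed
  have AF: "A' * F = F * diag_of (Suc n) d'"
    unfolding F_def A'b Db using U A3 D1 AU
    by (simp add: mult_four_block_mat[of _ 1 1 _ n _ n _ _ 1 _ n])
  have Dc: "diag_of (Suc n) d' \<in> carrier_mat (Suc n) (Suc n)" by (simp add: diag_of_def)
  have cF: "ctrans F \<in> carrier_mat (Suc n) (Suc n)" using F by simp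
  note as = assoc_mult_mat[of _ "Suc n" "Suc n" _ "Suc n" _ "Suc n"]
  have "ctrans (W * F) * (W * F) = ctrans F * ((ctrans W * W) * F)"
    using W(1) F cW cF by (simp add: ctrans_mult[OF W(1) F] as)
  then have 1: "ctrans (W * F) * (W * F) = 1\<^sub>m (Suc n)" using W(2) F FF by simp
  \<comment> \<open>Inserting \<open>W * ctrans W = 1\<^sub>m (Suc n)\<close> on the left turns
    \<open>A\<close> into its conjugate \<open>A'\<close>.\<close>
  have "A * (W * F) = (W * ctrans W) * (A * (W * F))" using A W(1) F by (simp add: WW)
  also have "\<dots> = W * (A' * F)" unfolding A'_def using A W(1) F cW by (simp add: as)
  also have "\<dots> = (W * F) * diag_of (Suc n) d'" unfolding AF using W(1) F Dc by (simp add: as)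
  finally have 2: "A * (W * F) = (W * F) * diag_of (Suc n) d'" .
  have "W * F \<in> carrier_mat (Suc n) (Suc n)" using W F by simp
  with 1 2 show ?case by blast
qed

section \<open>Spectrum and quadratic forms\<close>

definition adj_mat :: "nat \<Rightarrow> (nat \<Rightarrow> nat \<Rightarrow> bool) \<Rightarrow> complex mat" where
  "adj_mat n E = mat n n (\<lambda>(i, j). if E i j then 1 else 0)"

text \<open>The product of the adjacency matrix with \<open>x\<close>, as a function of the row.
  Plain functions in place of vectors spare the carrier conditions.\<close>

definition nbsum :: "nat \<Rightarrow> (nat \<Rightarrow> nat \<Rightarrow> bool) \<Rightarrow> (nat \<Rightarrow> complex) \<Rightarrow> nat \<Rightarrow> complex" where
  "nbsum n E x i = (\<Sum>j | j < n \<and> E i j. x j)"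

lemma adj_mat_carrier [simp]: "adj_mat n E \<in> carrier_mat n n"
  by (simp add: adj_mat_def)

lemma nbsum_alt: "nbsum n E x i = (\<Sum>j<n. (if E i j then 1 else 0) * x j)"
  unfolding nbsum_def by (rule sum.mono_neutral_cong_left) auto

lemma char_poly_diag_of: "char_poly (diag_of n d) = (\<Prod>l<n. [:- d l, 1:])"
proof -
  have "char_poly (diag_of n d) = (\<Prod>a\<leftarrow>diag_mat (diag_of n d). [:- a, 1:])"
    by (rule char_poly_upper_triangular[of _ n]) (auto simp: diag_of_def)
  also have "diag_mat (diag_of n d) = map d [0..<n]"
    by (auto simp: diag_mat_def diag_of_def)
  finally show ?thesis
    by (simp add: prod.distinct_set_conv_list[symmetric] atLeast_upt o_def lessThan_atLeast0)
qed

text \<open>The spectral theorem in terms of sums: \<open>u l\<close> is column \<open>l\<close> of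
  the unitary matrix. Both orthogonality relations are recorded, \<open>ctrans U * U = 1\<close> for
  the columns and \<open>U * ctrans U = 1\<close> for the rows; the latter expresses completeness of
  the basis.\<close>

lemma adjacency_eigenbasis:
  assumes "symp E"
  obtains u :: "nat \<Rightarrow> nat \<Rightarrow> complex" and d :: "nat \<Rightarrow> real" where
    "char_poly (adj_mat n E) = (\<Prod>l<n. [:- of_real (d l), 1:])"
    "\<And>l m. l < n \<Longrightarrow> m < n \<Longrightarrow> (\<Sum>i<n. cnj (u l i) * u m i) = (if l = m then 1 else 0)"
    "\<And>i j. i < n \<Longrightarrow> j < n \<Longrightarrow> (\<Sum>l<n. u l i * cnj (u l j)) = (if i = j then 1 else 0)"
    "\<And>l i. l < n \<Longrightarrow> i < n \<Longrightarrow> nbsum n E (u l) i = of_real (d l) * u l i"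
proof -
  have "ctrans (adj_mat n E) = adj_mat n E"
    using assms by (intro eq_matI) (auto simp: adj_mat_def dest: sympD)
  then obtain U d where U: "U \<in> carrier_mat n n" "ctrans U * U = 1\<^sub>m n"
    and AU: "adj_mat n E * U = U * diag_of n d"
    using hermitian_unitary_diagonalization[OF adj_mat_carrier] by blast
  have cU: "ctrans U \<in> carrier_mat n n" using U by simp
  have UU: "U * ctrans U = 1\<^sub>m n"
    using mat_mult_left_right_inverse[OF cU U(1) U(2)] .
  have D: "diag_of n d \<in> carrier_mat n n" by (simp add: diag_of_def)
  define u where "u l i = U $$ (i, l)" for l i
  have on: "(\<Sum>i<n. cnj (u l i) * u m i) = (if l = m then 1 else 0)" if "l < n" "m < n" for l m
    using arg_cong[OF U(2), of "\<lambda>M. M $$ (l, m)"] that U(1)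
    by (simp add: scalar_prod_def u_def lessThan_atLeast0)
  have cp: "(\<Sum>l<n. u l i * cnj (u l j)) = (if i = j then 1 else 0)" if "i < n" "j < n" for i j
    using arg_cong[OF UU, of "\<lambda>M. M $$ (i, j)"] that U(1)
    by (simp add: scalar_prod_def u_def lessThan_atLeast0)
  have ev: "nbsum n E (u l) i = d l * u l i" if "l < n" "i < n" for l i
  proof -
    have "nbsum n E (u l) i = (adj_mat n E * U) $$ (i, l)"
      using that U(1) by (simp add: nbsum_alt scalar_prod_def u_def adj_mat_def lessThan_atLeast0)
    also have "\<dots> = (\<Sum>m<n. if m = l then U $$ (i, m) * d m else 0)"
      unfolding AU using that U(1)
      by (simp add: scalar_prod_def diag_of_def lessThan_atLeast0 if_distrib cong: if_cong)
    finally show ?thesis using that by (simp add: u_def mult.commute)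
  qed
  \<comment> \<open>\<open>d l\<close> is the value of the quadratic form at the unit vector
    \<open>u l\<close>; exchanging the summation indices shows that this value equals its
    conjugate.\<close>
  have real: "d l = of_real (Re (d l))" if "l < n" for l
  proof -
    have 1: "(\<Sum>i<n. cnj (u l i) * nbsum n E (u l) i) = d l"
      using on[OF that that] by (simp add: ev[OF that] mult.left_commute[of _ "d l"] sum_distrib_left[symmetric])
    have "cnj (\<Sum>i<n. cnj (u l i) * nbsum n E (u l) i)
        = (\<Sum>i<n. \<Sum>j<n. u l i * ((if E i j then 1 else 0) * cnj (u l j)))"
      unfolding nbsum_alt sum_distrib_left cnj_sum by (intro sum.cong refl) auto
    also have "\<dots> = (\<Sum>j<n. \<Sum>i<n. u l i * ((if E i j then 1 else 0) * cnj (u l j)))"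
      by (rule sum.swap)
    also have "\<dots> = (\<Sum>j<n. \<Sum>i<n. cnj (u l j) * ((if E j i then 1 else 0) * u l i))"
      using assms by (intro sum.cong refl) (auto dest: sympD)
    also have "\<dots> = (\<Sum>i<n. cnj (u l i) * nbsum n E (u l) i)"
      by (simp only: nbsum_alt sum_distrib_left)
    finally show ?thesis unfolding 1 by (metis Reals_cnj_iff of_real_Re)
  qed
  have "similar_mat_wit (adj_mat n E) (diag_of n d) U (ctrans U)"
  proof (rule similar_mat_witI[of _ _ n])
    have "adj_mat n E = adj_mat n E * (U * ctrans U)" unfolding UU by (simp add: right_mult_one_mat[OF adj_mat_carrier])
    also have "\<dots> = adj_mat n E * U * ctrans U" by (rule assoc_mult_mat[symmetric, OF adj_mat_carrier U(1) cU])
    finally show "adj_mat n E = U * diag_of n d * ctrans U" unfolding AU .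
  qed (use U UU cU D in auto)
  then have "char_poly (adj_mat n E) = (\<Prod>l<n. [:- d l, 1:])"
    using char_poly_similar[of "adj_mat n E" "diag_of n d"] unfolding similar_mat_def char_poly_diag_of by blast
  also have "\<dots> = (\<Prod>l<n. [:- of_real (Re (d l)), 1:])"
    by (rule prod.cong) (use real in auto)
  finally show ?thesis
    using that[of "\<lambda>l. Re (d l)" u] on cp ev real by simp
qed

section \<open>Counting eigenvalues beyond a threshold by Hermitian forms\<close>

text \<open>The Hermitian form of \<open>s * (A - c)\<close> for the adjacency matrix
  \<open>A\<close>. With \<open>s = 1\<close> its positive directions belong to eigenvalues above
  \<open>c\<close>, with \<open>s = -1\<close> to those below \<open>c\<close>.\<close>

definition hform :: "real \<Rightarrow> real \<Rightarrow> nat \<Rightarrow> (nat \<Rightarrow> nat \<Rightarrow> bool) \<Rightarrow> (nat \<Rightarrow> complex) \<Rightarrow> real" where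
  "hform s c n E x = s * (Re (\<Sum>i<n. cnj (x i) * nbsum n E x i) - c * (\<Sum>i<n. (cmod (x i))\<^sup>2))"

text \<open>No plane is positive definite for the form. A linearly dependent pair satisfies the
  condition through a vanishing combination.\<close>

definition inertia_le_one :: "real \<Rightarrow> real \<Rightarrow> nat \<Rightarrow> (nat \<Rightarrow> nat \<Rightarrow> bool) \<Rightarrow> bool" where
  "inertia_le_one s c n E \<longleftrightarrow>
     (\<forall>x y. \<exists>\<alpha> \<beta>. (\<alpha> \<noteq> 0 \<or> \<beta> \<noteq> 0) \<and> hform s c n E (\<lambda>i. \<alpha> * x i + \<beta> * y i) \<le> 0)"

text \<open>Sylvester's law for index one: in the eigenbasis the form is diagonal with weights
  \<open>s * (d l - c)\<close>.\<close>

lemma inertia_le_one_iff: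
  fixes d :: "nat \<Rightarrow> real"
  assumes orth: "\<And>l m. l < n \<Longrightarrow> m < n \<Longrightarrow> (\<Sum>i<n. cnj (u l i) * u m i) = (if l = m then 1 else 0)"
    and comp: "\<And>i j. i < n \<Longrightarrow> j < n \<Longrightarrow> (\<Sum>l<n. u l i * cnj (u l j)) = (if i = j then 1 else 0)"
    and eig: "\<And>l i. l < n \<Longrightarrow> i < n \<Longrightarrow> nbsum n E (u l) i = of_real (d l) * u l i"
  shows "inertia_le_one s c n E \<longleftrightarrow> card {l. l < n \<and> s * (d l - c) > 0} \<le> 1"
proof -
  define k where "k x l = (\<Sum>i<n. cnj (u l i) * x i)" for x l
  have expand: "x i = (\<Sum>l<n. k x l * u l i)" if "i < n" for x i
  proof -
    have "(\<Sum>l<n. k x l * u l i) = (\<Sum>l<n. \<Sum>j<n. x j * (u l i * cnj (u l j)))"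
      by (simp add: k_def sum_distrib_left mult_ac)
    also have "\<dots> = (\<Sum>j<n. x j * (\<Sum>l<n. u l i * cnj (u l j)))"
      by (subst sum.swap) (simp add: sum_distrib_left)
    also have "\<dots> = (\<Sum>j<n. if j = i then x j else 0)"
      using that by (intro sum.cong refl) (auto simp: comp)
    finally show ?thesis using that by simp
  qed
  \<comment> \<open>The weights \<open>w\<close> serve two purposes: the eigenvalues give the
    quadratic form, the constant 1 gives the squared norm.\<close>
  have parseval: "(\<Sum>i<n. cnj (x i) * (\<Sum>l<n. w l * k x l * u l i)) = (\<Sum>l<n. w l * (cmod (k x l))\<^sup>2)"
    for x and w :: "nat \<Rightarrow> complex"
  proof -
    have "(\<Sum>i<n. cnj (x i) * (\<Sum>l<n. w l * k x l * u l i))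
        = (\<Sum>l<n. \<Sum>i<n. w l * k x l * (u l i * cnj (x i)))"
      by (subst sum.swap) (simp add: sum_distrib_left mult_ac)
    also have "\<dots> = (\<Sum>l<n. w l * k x l * cnj (k x l))"
      unfolding sum_distrib_left[symmetric] by (simp add: k_def)
    finally show ?thesis by (simp add: complex_norm_square[symmetric] mult.assoc)
  qed
  have nb: "nbsum n E x i = (\<Sum>l<n. of_real (d l) * k x l * u l i)" if "i < n" for x i
  proof -
    have "nbsum n E x i = (\<Sum>j<n. (if E i j then 1 else 0) * (\<Sum>l<n. k x l * u l j))"
      unfolding nbsum_alt by (intro sum.cong refl) (simp add: expand[symmetric])
    also have "\<dots> = (\<Sum>l<n. k x l * nbsum n E (u l) i)"
      unfolding nbsum_alt sum_distrib_left by (subst sum.swap) (simp only: mult_ac)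
    finally show ?thesis using that by (simp add: eig mult_ac)
  qed
  have form: "hform s c n E x = (\<Sum>l<n. s * (d l - c) * (cmod (k x l))\<^sup>2)" for x
  proof -
    have "(\<Sum>i<n. cnj (x i) * nbsum n E x i) = (\<Sum>l<n. of_real (d l) * (cmod (k x l))\<^sup>2)"
      using parseval[of x "\<lambda>l. of_real (d l)"] by (simp add: nb)
    moreover have "complex_of_real (\<Sum>i<n. (cmod (x i))\<^sup>2) = (\<Sum>i<n. cnj (x i) * (\<Sum>l<n. 1 * k x l * u l i))"
      by (simp only: of_real_sum complex_norm_square mult_1_left, intro sum.cong refl)
        (simp add: expand[symmetric] mult.commute)
    then have "complex_of_real (\<Sum>i<n. (cmod (x i))\<^sup>2) = complex_of_real (\<Sum>l<n. (cmod (k x l))\<^sup>2)"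
      unfolding parseval[of x "\<lambda>_. 1"] by simp
    then have "(\<Sum>i<n. (cmod (x i))\<^sup>2) = (\<Sum>l<n. (cmod (k x l))\<^sup>2)" by (simp only: of_real_eq_iff)
    ultimately show ?thesis
      by (simp add: hform_def sum_distrib_left sum_subtractf algebra_simps)
  qed
  have lin: "k (\<lambda>i. a * x i + b * y i) l = a * k x l + b * k y l" for a b x y l
    by (simp add: k_def algebra_simps sum.distrib sum_distrib_left)
  let ?P = "{l. l < n \<and> s * (d l - c) > 0}"
  have fin: "finite ?P" by simp
  show ?thesis
  proof
    assume "card ?P \<le> 1"
    then have "\<forall>l\<in>?P. \<forall>m\<in>?P. l = m" unfolding One_nat_def card_le_Suc0_iff_eq[OF fin] .
    then have "\<exists>m. ?P \<subseteq> {m}" by (cases "?P = {}") blast+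
    then obtain m where m: "?P \<subseteq> {m}" ..
    show "inertia_le_one s c n E"
      unfolding inertia_le_one_def
    proof (intro allI)
      fix x y
      \<comment> \<open>One linear equation in two unknowns: a nontrivial combination has no
        component at \<open>m\<close>, the only index whose weight may be positive.\<close>
      obtain a b where ab: "a \<noteq> 0 \<or> b \<noteq> 0" "a * k x m + b * k y m = 0"
      proof (cases "k x m = 0 \<and> k y m = 0")
        case True
        then show ?thesis using that[of 1 0] by simp
      next
        case False
        then show ?thesis using that[of "k y m" "- k x m"] by auto
      qed
      have "hform s c n E (\<lambda>i. a * x i + b * y i) \<le> 0"
        unfolding form
      proof (rule sum_nonpos)
        fix l assume "l \<in> {..<n}"
        then consider "l = m" | "s * (d l - c) \<le> 0" using m by fastforce
        then show "s * (d l - c) * (cmod (k (\<lambda>i. a * x i + b * y i) l))\<^sup>2 \<le> 0"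
          using ab(2) by cases (auto simp: lin intro: mult_nonpos_nonneg)
      qed
      with ab(1) show "\<exists>\<alpha> \<beta>. (\<alpha> \<noteq> 0 \<or> \<beta> \<noteq> 0) \<and> hform s c n E (\<lambda>i. \<alpha> * x i + \<beta> * y i) \<le> 0"
        by blast
    qed
  next
    assume inert: "inertia_le_one s c n E"
    show "card ?P \<le> 1"
    proof (rule ccontr)
      assume "\<not> card ?P \<le> 1"
      then obtain l m where lm: "l \<in> ?P" "m \<in> ?P" "l \<noteq> m"
        unfolding One_nat_def card_le_Suc0_iff_eq[OF fin] by blast
      \<comment> \<open>Two eigenvectors with positive weights span a positive definite plane, so no
        such combination can exist.\<close>
      obtain a b where ab: "a \<noteq> 0 \<or> b \<noteq> 0" "hform s c n E (\<lambda>i. a * u l i + b * u m i) \<le> 0"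
        using inert unfolding inertia_le_one_def by blast
      have ku: "k (u j) i = (if i = j then 1 else 0)" if "i < n" "j < n" for i j
        using that by (simp add: k_def orth)
      have "hform s c n E (\<lambda>i. a * u l i + b * u m i)
          = (\<Sum>i<n. (if i = l then s * (d l - c) * (cmod a)\<^sup>2 else 0)
                  + (if i = m then s * (d m - c) * (cmod b)\<^sup>2 else 0))"
        unfolding form lin using lm by (intro sum.cong refl) (auto simp: ku)
      also have "\<dots> = s * (d l - c) * (cmod a)\<^sup>2 + s * (d m - c) * (cmod b)\<^sup>2"
        using lm by (simp add: sum.distrib)
      also have "\<dots> > 0"
      proof (cases "a = 0")
        case True
        then show ?thesis using ab(1) lm by simp
      next
        case False
        then show ?thesis using lm by (intro add_pos_nonneg) auto
      qed
      finally show False using ab(2) by simp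
    qed
  qed
qed

text \<open>By \<open>inertia_le_one_iff\<close> the condition counts eigenvalues with multiplicity,
  so it is an invariant of the spectrum.\<close>

lemma inertia_le_one_cospectral:
  assumes "symp E" "symp F"
    and eq: "proots (char_poly (adj_mat n E)) = proots (char_poly (adj_mat n F))"
    and F: "inertia_le_one s c n F"
  shows "inertia_le_one s c n E"
proof -
  have pr: "proots (\<Prod>l<n. [:- complex_of_real (d l), 1:]) = image_mset of_real (image_mset d (mset_set {..<n}))" for d
    by (subst proots_prod) (auto simp: sum_unfold_sum_mset multiset.map_comp o_def)
  have cd: "card {l. l < n \<and> P (d l)} = size (filter_mset P (image_mset d (mset_set {..<n})))" for d P
    by (simp add: filter_mset_image_mset filter_mset_mset_set)
  obtain u d where u: "char_poly (adj_mat n E) = (\<Prod>l<n. [:- of_real (d l), 1:])"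
    "\<And>l m. l < n \<Longrightarrow> m < n \<Longrightarrow> (\<Sum>i<n. cnj (u l i) * u m i) = (if l = m then 1 else 0)"
    "\<And>i j. i < n \<Longrightarrow> j < n \<Longrightarrow> (\<Sum>l<n. u l i * cnj (u l j)) = (if i = j then 1 else 0)"
    "\<And>l i. l < n \<Longrightarrow> i < n \<Longrightarrow> nbsum n E (u l) i = of_real (d l) * u l i"
    by (rule adjacency_eigenbasis[OF assms(1), of n]) blast
  obtain v e where v: "char_poly (adj_mat n F) = (\<Prod>l<n. [:- of_real (e l), 1:])"
    "\<And>l m. l < n \<Longrightarrow> m < n \<Longrightarrow> (\<Sum>i<n. cnj (v l i) * v m i) = (if l = m then 1 else 0)"
    "\<And>i j. i < n \<Longrightarrow> j < n \<Longrightarrow> (\<Sum>l<n. v l i * cnj (v l j)) = (if i = j then 1 else 0)"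
    "\<And>l i. l < n \<Longrightarrow> i < n \<Longrightarrow> nbsum n F (v l) i = of_real (e l) * v l i"
    by (rule adjacency_eigenbasis[OF assms(2), of n]) blast
  \<comment> \<open>\<open>Re\<close> undoes the embedding of the real eigenvalues, so equal complex
    multisets come from equal real ones.\<close>
  have inv: "image_mset Re (image_mset complex_of_real A) = A" for A
    by (simp add: multiset.map_comp o_def)
  have "image_mset d (mset_set {..<n}) = image_mset e (mset_set {..<n})"
    using eq unfolding u(1) v(1) pr by (metis inv)
  moreover have "inertia_le_one s c n E \<longleftrightarrow> card {l. l < n \<and> s * (d l - c) > 0} \<le> 1"
    by (rule inertia_le_one_iff) (fact u)+
  moreover have "inertia_le_one s c n F \<longleftrightarrow> card {l. l < n \<and> s * (e l - c) > 0} \<le> 1"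
    by (rule inertia_le_one_iff) (fact v)+
  ultimately show ?thesis
    using F cd[of "\<lambda>t. s * (t - c) > 0" d] cd[of "\<lambda>t. s * (t - c) > 0" e] by simp
qed

lemma root_char_poly_adj_mat:
  "poly (char_poly (adj_mat n E)) ev = 0 \<longleftrightarrow>
     (\<exists>x. (\<exists>i<n. x i \<noteq> 0) \<and> (\<forall>i<n. nbsum n E x i = ev * x i))"
proof -
  have nb: "(adj_mat n E *\<^sub>v v) $ i = nbsum n E (\<lambda>i. v $ i) i" if "v \<in> carrier_vec n" "i < n" for v i
    using that by (simp add: nbsum_alt adj_mat_def scalar_prod_def lessThan_atLeast0)
  show ?thesis
    unfolding eigenvalue_root_char_poly[OF adj_mat_carrier, symmetric]
  proof
    assume "eigenvalue (adj_mat n E) ev"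
    then obtain v where v: "v \<in> carrier_vec n" "v \<noteq> 0\<^sub>v n" "adj_mat n E *\<^sub>v v = ev \<cdot>\<^sub>v v"
      unfolding eigenvalue_def eigenvector_def by (auto simp: adj_mat_def)
    have "\<exists>i<n. v $ i \<noteq> 0" using v(1,2) by (metis carrier_vecD eq_vecI index_zero_vec)
    moreover have "nbsum n E (\<lambda>i. v $ i) i = ev * v $ i" if "i < n" for i
      using nb[OF v(1) that] v that by simp
    ultimately show "\<exists>x. (\<exists>i<n. x i \<noteq> 0) \<and> (\<forall>i<n. nbsum n E x i = ev * x i)" by blast
  next
    assume "\<exists>x. (\<exists>i<n. x i \<noteq> 0) \<and> (\<forall>i<n. nbsum n E x i = ev * x i)"
    then obtain x where x: "\<exists>i<n. x i \<noteq> 0" "\<And>i. i < n \<Longrightarrow> nbsum n E x i = ev * x i" by blast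
    have v: "vec n x \<in> carrier_vec n" by simp
    have "adj_mat n E *\<^sub>v vec n x = ev \<cdot>\<^sub>v vec n x"
    proof (rule eq_vecI)
      fix i assume "i < dim_vec (ev \<cdot>\<^sub>v vec n x)"
      then have "i < n" by simp
      moreover have "nbsum n E (\<lambda>i. vec n x $ i) i = nbsum n E x i"
        unfolding nbsum_def by (rule sum.cong) auto
      ultimately show "(adj_mat n E *\<^sub>v vec n x) $ i = (ev \<cdot>\<^sub>v vec n x) $ i"
        using nb[OF v] x(2) by simp
    qed (simp add: adj_mat_def)
    moreover have "vec n x \<noteq> 0\<^sub>v n" using x(1) by (metis index_vec index_zero_vec(1))
    ultimately show "eigenvalue (adj_mat n E) ev"
      unfolding eigenvalue_def eigenvector_def
      by (intro exI[of _ "vec n x"]) (simp add: carrier_matD(1)[OF adj_mat_carrier])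
  qed
qed

section \<open>Forbidden configurations\<close>

text \<open>The real bilinear form of the same matrix \<open>s * (A - c)\<close>; the test vectors
  below are real.\<close>

definition rform :: "real \<Rightarrow> real \<Rightarrow> nat \<Rightarrow> (nat \<Rightarrow> nat \<Rightarrow> bool) \<Rightarrow> (nat \<Rightarrow> real) \<Rightarrow> (nat \<Rightarrow> real) \<Rightarrow> real" where
  "rform s c n E x y = s * ((\<Sum>i<n. \<Sum>j<n. if E i j then x i * y j else 0) - c * (\<Sum>i<n. x i * y i))"

text \<open>Termwise \<open>Re (cnj a * b) = Re a * Re b + Im a * Im b\<close>, so real and
  imaginary parts contribute separately.\<close>

lemma hform_rform:
  "hform s c n E x = rform s c n E (\<lambda>i. Re (x i)) (\<lambda>i. Re (x i)) + rform s c n E (\<lambda>i. Im (x i)) (\<lambda>i. Im (x i))"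
proof -
  have "Re (\<Sum>i<n. cnj (x i) * nbsum n E x i)
      = (\<Sum>i<n. \<Sum>j<n. (if E i j then Re (x i) * Re (x j) else 0) + (if E i j then Im (x i) * Im (x j) else 0))"
    unfolding nbsum_alt sum_distrib_left Re_sum by (intro sum.cong refl) auto
  moreover have "(\<Sum>i<n. (cmod (x i))\<^sup>2) = (\<Sum>i<n. Re (x i) * Re (x i)) + (\<Sum>i<n. Im (x i) * Im (x i))"
    by (simp only: cmod_power2 sum.distrib) (simp add: power2_eq_square)
  ultimately show ?thesis
    by (simp add: hform_def rform_def sum.distrib algebra_simps)
qed

lemma rform_lincomb:
  assumes "symp E"
  shows "rform s c n E (\<lambda>i. a * x i + b * y i) (\<lambda>i. a * x i + b * y i)
    = a\<^sup>2 * rform s c n E x x + 2 * a * b * rform s c n E x y + b\<^sup>2 * rform s c n E y y"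
proof -
  let ?S = "\<lambda>x y. \<Sum>i<n. \<Sum>j<n. if E i j then x i * y j else (0::real)"
  let ?z = "\<lambda>i. a * x i + b * y i"
  have "?S y x = (\<Sum>j<n. \<Sum>i<n. if E i j then y i * x j else 0)" by (rule sum.swap)
  also have "\<dots> = ?S x y" using assms by (intro sum.cong refl) (auto dest: sympD)
  finally have sym: "?S y x = ?S x y" .
  have "?S ?z ?z = (\<Sum>i<n. \<Sum>j<n. a\<^sup>2 * (if E i j then x i * x j else 0) + a * b * (if E i j then x i * y j else 0)
      + a * b * (if E i j then y i * x j else 0) + b\<^sup>2 * (if E i j then y i * y j else 0))"
    by (intro sum.cong refl) (auto simp: algebra_simps power2_eq_square)
  also have "\<dots> = a\<^sup>2 * ?S x x + a * b * ?S x y + a * b * ?S y x + b\<^sup>2 * ?S y y"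
    by (simp add: sum.distrib sum_distrib_left)
  finally have 1: "?S ?z ?z = a\<^sup>2 * ?S x x + 2 * a * b * ?S x y + b\<^sup>2 * ?S y y"
    unfolding sym by simp
  have "(\<Sum>i<n. ?z i * ?z i) = (\<Sum>i<n. a\<^sup>2 * (x i * x i) + 2 * a * b * (x i * y i) + b\<^sup>2 * (y i * y i))"
    by (intro sum.cong refl) (auto simp: algebra_simps power2_eq_square)
  then have 2: "(\<Sum>i<n. ?z i * ?z i) = a\<^sup>2 * (\<Sum>i<n. x i * x i) + 2 * a * b * (\<Sum>i<n. x i * y i) + b\<^sup>2 * (\<Sum>i<n. y i * y i)"
    by (simp add: sum.distrib sum_distrib_left)
  show ?thesis unfolding rform_def 1 2 by (simp add: algebra_simps)
qed

text \<open>If the inequality failed, the Gram determinant of \<open>x\<close> and \<open>y\<close>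
  would be positive, and the form would be positive definite on their span.\<close>

lemma reverse_Cauchy_Schwarz:
  assumes "symp E" and inert: "inertia_le_one s c n E" and pos: "rform s c n E x x > 0"
  shows "rform s c n E x x * rform s c n E y y \<le> (rform s c n E x y)\<^sup>2"
proof (rule ccontr)
  define A B C where "A = rform s c n E x x" and "B = rform s c n E x y" and "C = rform s c n E y y"
  assume "\<not> ?thesis"
  then have disc: "A * C - B\<^sup>2 > 0" by (simp add: A_def B_def C_def)
  have A: "A > 0" using pos by (simp add: A_def)
  obtain a b :: complex where ab: "a \<noteq> 0 \<or> b \<noteq> 0"
    and le: "hform s c n E (\<lambda>i. a * of_real (x i) + b * of_real (y i)) \<le> 0"
    using inert[unfolded inertia_le_one_def, rule_format, of "\<lambda>i. of_real (x i)" "\<lambda>i. of_real (y i)"]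
    by (elim exE conjE) (rule that)
  define q where "q u v = u\<^sup>2 * A + 2 * u * v * B + v\<^sup>2 * C" for u v
  \<comment> \<open>Completing the square exhibits \<open>q\<close> as positive definite.\<close>
  have qA: "A * q u v = (u * A + v * B)\<^sup>2 + (A * C - B\<^sup>2) * v\<^sup>2" for u v
    by (simp add: q_def power2_eq_square algebra_simps)
  have q0: "q u v \<ge> 0" for u v
  proof -
    have "A * q u v \<ge> 0" unfolding qA using disc by (intro add_nonneg_nonneg) auto
    then show ?thesis using A by (simp add: zero_le_mult_iff)
  qed
  have qz: "u = 0 \<and> v = 0" if "q u v \<le> 0" for u v
  proof -
    have "q u v = 0" using q0[of u v] that by simp
    then have "(u * A + v * B)\<^sup>2 + (A * C - B\<^sup>2) * v\<^sup>2 = 0" using qA[of u v] by simp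
    moreover have "(A * C - B\<^sup>2) * v\<^sup>2 \<ge> 0" using disc by simp
    ultimately have "(A * C - B\<^sup>2) * v\<^sup>2 = 0" "(u * A + v * B)\<^sup>2 = 0"
      using zero_le_power2[of "u * A + v * B"] by linarith+
    then show ?thesis using disc A by auto
  qed
  \<comment> \<open>The combination may have complex coefficients. Since \<open>x\<close> and
    \<open>y\<close> are real, it contributes one value of \<open>q\<close> for the real parts and
    one for the imaginary parts of \<open>a\<close> and \<open>b\<close>.\<close>
  have "hform s c n E (\<lambda>i. a * of_real (x i) + b * of_real (y i)) = q (Re a) (Re b) + q (Im a) (Im b)"
    unfolding hform_rform q_def A_def B_def C_def
    by (simp add: rform_lincomb[OF assms(1)])
  then have "q (Re a) (Re b) \<le> 0" "q (Im a) (Im b) \<le> 0"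
    using le q0[of "Re a" "Re b"] q0[of "Im a" "Im b"] by linarith+
  then show False using qz ab by (metis complex_eq_0 power_zero_numeral add_0 complex_eq_iff zero_complex.sel)
qed

lemma rform_support:
  assumes "S \<subseteq> {..<n}" "\<And>i. i \<notin> S \<Longrightarrow> x i = 0" "\<And>i. i \<notin> S \<Longrightarrow> y i = 0"
  shows "rform s c n E x y = s * ((\<Sum>i\<in>S. \<Sum>j\<in>S. if E i j then x i * y j else 0) - c * (\<Sum>i\<in>S. x i * y i))"
proof -
  have "(\<Sum>j\<in>S. if E i j then x i * y j else 0) = (\<Sum>j<n. if E i j then x i * y j else 0)" for i
    using assms by (intro sum.mono_neutral_left) auto
  moreover have "(\<Sum>i\<in>S. \<Sum>j<n. if E i j then x i * y j else 0) = (\<Sum>i<n. \<Sum>j<n. if E i j then x i * y j else 0)"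
    using assms by (intro sum.mono_neutral_left) (auto intro!: sum.neutral)
  moreover have "(\<Sum>i\<in>S. x i * y i) = (\<Sum>i<n. x i * y i)"
    using assms by (intro sum.mono_neutral_left) auto
  ultimately show ?thesis by (simp add: rform_def)
qed

text \<open>If \<open>c\<close> were adjacent to neither end of the edge between \<open>a\<close>
  and \<open>b\<close>, this edge and the one between \<open>c\<close> and \<open>d\<close> would
  produce two positive eigenvalues.\<close>

lemma nonadjacency_cotransitive:
  assumes sym: "symp E" and irr: "irreflp E" and inert: "inertia_le_one 1 0 n E"
    and lt: "a < n" "b < n" "c < n" "d < n"
    and ab: "E a b" and cd: "E c d" and ca: "\<not> E c a"
  shows "E c b"
proof (rule ccontr)
  assume cb: "\<not> E c b"
  \<comment> \<open>The weight 2 on \<open>c\<close> is needed when \<open>d\<close> is adjacent to both \<open>a\<close> and \<open>b\<close>; the choice works in all cases.\<close>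
  define x y :: "nat \<Rightarrow> real" where "x i = (if i = a \<or> i = b then 1 else 0)"
    and "y i = (if i = d then 1 else if i = c then 2 else 0)" for i
  have irr': "\<not> E i i" for i using irr by (simp add: irreflpD)
  have sym': "E i j \<longleftrightarrow> E j i" for i j using sym by (auto dest: sympD)
  have ne: "a \<noteq> b" "c \<noteq> d" "c \<noteq> a" "c \<noteq> b" "d \<noteq> a" "d \<noteq> b"
    using irr' ab cd ca cb sym' by metis+
  note sup = rform_support[of "{a, b, c, d}" n]
  have Es: "E b a" "E d c" "\<not> E a c" "\<not> E b c" using ab cd ca cb sym' by metis+
  note facts = ne ne[symmetric] irr' ab cd ca cb Es
  have lt': "{a, b, c, d} \<subseteq> {..<n}" using lt by auto
  have "rform 1 0 n E x x = 2"
    by (subst sup[OF lt']) (auto simp: facts x_def)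
  moreover have "rform 1 0 n E y y = 4"
    by (subst sup[OF lt']) (auto simp: facts y_def)
  moreover have "rform 1 0 n E x y = (if E a d then 1 else 0) + (if E b d then 1 else 0)"
    by (subst sup[OF lt']) (simp_all add: facts x_def y_def)
  \<comment> \<open>The inequality demands that 8 be at most the square of a number that is at most
    2.\<close>
  ultimately show False
    using reverse_Cauchy_Schwarz[OF sym inert, of x y] by (auto split: if_splits)
qed

text \<open>Interlacing in the language of forms: the five vertices induce a wheel with two
  eigenvalues below -1, while the whole graph has at most one.\<close>

lemma no_induced_K122:
  assumes sym: "symp E" and irr: "irreflp E" and inert: "inertia_le_one (-1) (-1) n E"
    and lt: "s < n" "p < n" "p' < n" "q < n" "q' < n"
    and E1: "E s p" "E s p'" "E s q" "E s q'" "E p q" "E p q'" "E p' q" "E p' q'"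
    and ne: "p \<noteq> p'" "\<not> E p p'" "q \<noteq> q'" "\<not> E q q'"
  shows False
proof -
  \<comment> \<open>\<open>x\<close> is an eigenvector of the graph \<open>K\<^sub>1\<^sub>,\<^sub>2\<^sub>,\<^sub>2\<close> for $-2$, and \<open>y\<close> approximates one for $1 - 5^{1/2} < -1$.\<close>
  define x y :: "nat \<Rightarrow> real" where "x i = (if i = p \<or> i = p' then 1 else if i = q \<or> i = q' then -1 else 0)"
    and "y i = (if i = s then 3 else if i = p \<or> i = p' \<or> i = q \<or> i = q' then -1 else 0)" for i
  have irr': "\<not> E i i" for i using irr by (simp add: irreflpD)
  have sym': "E i j \<longleftrightarrow> E j i" for i j using sym by (auto dest: sympD)
  have E2: "E p s" "E p' s" "E q s" "E q' s" "E q p" "E q' p" "E q p'" "E q' p'" "\<not> E p' p" "\<not> E q' q"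
    using E1 ne sym' by metis+
  have ne': "s \<noteq> p" "s \<noteq> p'" "s \<noteq> q" "s \<noteq> q'" "p \<noteq> q" "p \<noteq> q'" "p' \<noteq> q" "p' \<noteq> q'"
    using E1 irr' by metis+
  note sup = rform_support[of "{s, p, p', q, q'}" n]
  note facts = ne ne' ne(1,3)[symmetric] ne'[symmetric] irr' E1 E2
  have lt': "{s, p, p', q, q'} \<subseteq> {..<n}" using lt by auto
  have "rform (-1) (-1) n E x x = 4"
    by (subst sup[OF lt']) (auto simp: facts x_def)
  moreover have "rform (-1) (-1) n E y y = 3"
    by (subst sup[OF lt']) (auto simp: facts y_def)
  moreover have "rform (-1) (-1) n E x y = 0"
    by (subst sup[OF lt']) (auto simp: facts x_def y_def)
  ultimately show False
    using reverse_Cauchy_Schwarz[OF sym inert, of x y] by simp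
qed

text \<open>On the non-isolated vertices \<open>W\<close> the graph is complete multipartite, with
  parts the classes \<open>K i\<close> of non-adjacency. Without a singleton part, an eigenvector
  for -1 with sum \<open>S\<close> has the value \<open>S / (card (K i) - 1)\<close> on
  \<open>K i\<close>. Summing over all parts gives that the numbers
  \<open>card K / (card K - 1)\<close> add up to 1, yet each of them exceeds 1.\<close>

lemma dominating_vertex_exists:
  fixes E :: "nat \<Rightarrow> nat \<Rightarrow> bool"
  assumes sym: "symp E" and irr: "irreflp E"
    and trans: "\<And>i j l. i \<in> W \<Longrightarrow> j \<in> W \<Longrightarrow> l \<in> W \<Longrightarrow> \<not> E i j \<Longrightarrow> \<not> E j l \<Longrightarrow> \<not> E i l"
    and W: "W = {i. i < n \<and> (\<exists>j<n. E i j)}"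
    and x: "\<exists>i<n. x i \<noteq> 0" "\<And>i. i < n \<Longrightarrow> nbsum n E x i = - x i"
  shows "\<exists>s\<in>W. \<forall>j\<in>W. j \<noteq> s \<longrightarrow> E s j"
proof (rule ccontr)
  assume no: "\<not> ?thesis"
  have irr': "\<not> E i i" for i using irr by (simp add: irreflpD)
  have sym': "E i j \<longleftrightarrow> E j i" for i j using sym by (auto dest: sympD)
  have fW: "finite W" by (simp add: W)
  define K where "K i = {j \<in> W. \<not> E i j}" for i
  have fK: "finite (K i)" for i using fW by (simp add: K_def)
  have K2: "card (K i) \<ge> 2" if i: "i \<in> W" for i
  proof -
    obtain j where "j \<in> W" "j \<noteq> i" "\<not> E i j" using no i by blast
    then have "{i, j} \<subseteq> K i" using i irr' by (auto simp: K_def)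
    moreover have "card {i, j} = 2" using \<open>j \<noteq> i\<close> by auto
    ultimately show ?thesis by (metis card_mono fK)
  qed
  have KK: "K j = K i" if "i \<in> W" "j \<in> K i" for i j
    using that trans sym' unfolding K_def by blast
  \<comment> \<open>At an isolated vertex the eigenvalue equation reads
    \<open>0 = - x i\<close>.\<close>
  have x0: "x i = 0" if "i < n" "i \<notin> W" for i
  proof -
    have "nbsum n E x i = 0" unfolding nbsum_def using that by (intro sum.neutral) (auto simp: W)
    then show ?thesis using x(2) that by simp
  qed
  define S where "S = sum x W"
  have nbs: "nbsum n E x i = S - sum x (K i)" if "i \<in> W" for i
  proof -
    have "nbsum n E x i = sum x (W - K i)"
      unfolding nbsum_def K_def by (rule sum.cong) (use sym' that in \<open>auto simp: W\<close>)
    then show ?thesis using fW by (simp add: S_def sum_diff K_def)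
  qed
  \<comment> \<open>Vertices of one part have the same neighbours, hence the same
    \<open>nbsum\<close>.\<close>
  have const: "x j = x i" if "i \<in> W" "j \<in> K i" for i j
  proof -
    have "j \<in> W" "j < n" "i < n" using that by (auto simp: K_def W)
    then show ?thesis
      using nbs[OF that(1)] nbs[OF \<open>j \<in> W\<close>] x(2) KK[OF that] by (metis neg_equal_iff_equal)
  qed
  have Sx: "S = of_nat (card (K i) - 1) * x i" if i: "i \<in> W" for i
  proof -
    have "sum x (K i) = of_nat (card (K i)) * x i"
      using const[OF i] by simp
    moreover have "nbsum n E x i = - x i" using x(2) i by (auto simp: W)
    ultimately have "S = of_nat (card (K i)) * x i - x i" using nbs[OF i] by (simp add: algebra_simps)
    then show ?thesis using K2[OF i] by (simp add: of_nat_diff algebra_simps)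
  qed
  obtain i0 where i0: "i0 \<in> W" "x i0 \<noteq> 0" using x(1) x0 by blast
  have S0: "S \<noteq> 0" using Sx[OF i0(1)] K2[OF i0(1)] i0(2) by simp
  define r where "r i = 1 / real (card (K i) - 1)" for i
  have xr: "x i = S * of_real (r i)" if "i \<in> W" for i
    using Sx[OF that] K2[OF that] by (simp add: r_def field_simps)
  have "S = S * of_real (sum r W)"
    unfolding of_real_sum sum_distrib_left S_def[symmetric] by (subst S_def, rule sum.cong) (use xr in auto)
  then have "sum r W = 1" using S0 by (metis mult_cancel_left1 of_real_eq_1_iff mult.commute)
  \<comment> \<open>A single part already contributes more than the total of 1.\<close>
  moreover have "sum r (K i0) \<le> sum r W"
    using fW by (intro sum_mono2) (auto simp: K_def r_def)
  moreover have "sum r (K i0) = real (card (K i0)) * r i0"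
    using KK[OF i0(1)] by (simp add: r_def)
  moreover have "real (card (K i0)) * r i0 > 1"
    using K2[OF i0(1)] by (simp add: r_def field_simps of_nat_diff)
  ultimately show False by linarith
qed

section \<open>Complete split graphs\<close>

text \<open>\<open>C\<close> collects the dominating vertices of \<open>W\<close>, and
  \<open>I\<close> the rest of \<open>W\<close>. A clique could be read with \<open>I\<close> empty
  or with one vertex in \<open>I\<close>; the conclusion \<open>I \<noteq> {}\<close> fixes the
  second reading, as the comparison of parameters requires.\<close>

lemma complete_split_structure:
  assumes sym: "symp E" and irr: "irreflp E"
    and pos: "inertia_le_one 1 0 n E" and neg: "inertia_le_one (-1) (-1) n E"
    and x: "\<exists>i<n. x i \<noteq> 0" "\<And>i. i < n \<Longrightarrow> nbsum n E x i = - x i"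
  obtains C I where "C \<subseteq> {..<n}" "I \<subseteq> {..<n}" "C \<inter> I = {}" "I \<noteq> {}"
    "\<And>i j. i \<in> C \<Longrightarrow> j \<in> C \<union> I \<Longrightarrow> E i j \<longleftrightarrow> i \<noteq> j"
    "\<And>i j. i \<in> I \<Longrightarrow> j \<in> I \<Longrightarrow> \<not> E i j"
    "\<And>i j. i < n \<Longrightarrow> j < n \<Longrightarrow> E i j \<Longrightarrow> i \<in> C \<union> I"
proof -
  have irr': "\<not> E i i" for i using irr by (simp add: irreflpD)
  have sym': "E i j \<longleftrightarrow> E j i" for i j using sym by (auto dest: sympD)
  define W where "W = {i. i < n \<and> (\<exists>j<n. E i j)}"
  have Wn: "i < n" if "i \<in> W" for i using that by (simp add: W_def)
  \<comment> \<open>Cotransitivity for the edge between \<open>i\<close> and \<open>l\<close> and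
    the vertex \<open>j\<close>, which has a neighbour because it lies in \<open>W\<close>.\<close>
  have trans: "\<not> E i l" if ijl: "i \<in> W" "j \<in> W" "l \<in> W" "\<not> E i j" "\<not> E j l" for i j l
  proof
    assume il: "E i l"
    obtain d where d: "d < n" "E j d" using ijl(2) unfolding W_def by blast
    have "\<not> E j i" using ijl(4) sym' by blast
    then have "E j l"
      by (rule nonadjacency_cotransitive[OF sym irr pos Wn[OF ijl(1)] Wn[OF ijl(3)] Wn[OF ijl(2)] d(1) il d(2)])
    with ijl(5) show False by blast
  qed
  have "\<exists>s\<in>W. \<forall>j\<in>W. j \<noteq> s \<longrightarrow> E s j"
    by (rule dominating_vertex_exists[OF sym irr _ W_def x(1)]) (fact trans, fact x(2))
  then obtain s where s: "s \<in> W" "\<And>j. j \<in> W \<Longrightarrow> j \<noteq> s \<Longrightarrow> E s j" by blast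
  define D where "D = {i \<in> W. \<forall>j\<in>W. j \<noteq> i \<longrightarrow> E i j}"
  have sD: "s \<in> D" using s by (simp add: D_def)
  have ind: "\<not> E p q" if p: "p \<in> W - D" and q: "q \<in> W - D" for p q
  proof
    assume pq: "E p q"
    \<comment> \<open>Adjacent vertices \<open>p\<close>, \<open>q\<close> outside \<open>D\<close>
      have non-neighbours \<open>p'\<close>, \<open>q'\<close>; transitivity of non-adjacency
      supplies the remaining cross edges, and \<open>s\<close> completes the forbidden
      wheel.\<close>
    obtain p' where p': "p' \<in> W" "p' \<noteq> p" "\<not> E p p'" using p unfolding D_def by blast
    obtain q' where q': "q' \<in> W" "q' \<noteq> q" "\<not> E q q'" using q unfolding D_def by blast
    have W: "p \<in> W" "q \<in> W" using p q by auto
    have E1: "E p q'" using trans[OF W(1) q'(1) W(2)] pq q'(3) sym' by blast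
    have E2: "E p' q" using trans[OF W(1) p'(1) W(2)] pq p'(3) by blast
    have E3: "E p' q'" using trans[OF p'(1) q'(1) W(2)] E2 q'(3) sym' by blast
    have ns: "p \<noteq> s" "q \<noteq> s" using p q sD by auto
    have ns': "p' \<noteq> s" "q' \<noteq> s" using p' q' s(2) W ns sym' by metis+
    note Es = s(2)[OF W(1) ns(1)] s(2)[OF p'(1) ns'(1)] s(2)[OF W(2) ns(2)] s(2)[OF q'(1) ns'(2)]
    show False
      by (rule no_induced_K122[OF sym irr neg Wn[OF s(1)] Wn[OF W(1)] Wn[OF p'(1)] Wn[OF W(2)] Wn[OF q'(1)]
            Es pq E1 E2 E3 p'(2)[symmetric] p'(3) q'(2)[symmetric] q'(3)])
  qed
  \<comment> \<open>If \<open>W\<close> is a clique, one vertex is moved to the independent part to keep that part nonempty.\<close>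
  define C where "C = (if D = W then D - {s} else D)"
  have CD: "C \<subseteq> D" by (auto simp: C_def)
  have CW: "C \<subseteq> W" using CD by (auto simp: D_def)
  show ?thesis
  proof (rule that[of C "W - C"])
    show "C \<subseteq> {..<n}" "W - C \<subseteq> {..<n}" using Wn CW by auto
    show "C \<inter> (W - C) = {}" by blast
    show "W - C \<noteq> {}" using s(1) by (auto simp: C_def D_def)
    show "E i j \<longleftrightarrow> i \<noteq> j" if "i \<in> C" "j \<in> C \<union> (W - C)" for i j
    proof -
      have "i \<in> D" "j \<in> W" using that CD by (auto simp: D_def)
      then show ?thesis using irr' by (auto simp: D_def)
    qed
    show "\<not> E i j" if "i \<in> W - C" "j \<in> W - C" for i j
      \<comment> \<open>In the clique case \<open>W - C\<close> is \<open>{s}\<close> and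
        irreflexivity decides; otherwise it is \<open>W - D\<close>.\<close>
      using that ind[of i j] irr' by (auto simp: C_def split: if_splits)
    show "i \<in> C \<union> (W - C)" if "i < n" "j < n" "E i j" for i j
      using that by (auto simp: W_def)
  qed
qed

text \<open>Away from 0 and -1, an eigenvector vanishes on isolated vertices and is constant on
  \<open>C\<close> and on \<open>I\<close>. Its sums over \<open>C\<close> and \<open>I\<close> then
  satisfy a two by two linear system, whose characteristic equation is the claim.\<close>

lemma complete_split_eigenvalue:
  fixes ev :: complex
  assumes CI: "C \<subseteq> {..<n}" "I \<subseteq> {..<n}" "C \<inter> I = {}"
    and EC: "\<And>i j. i \<in> C \<Longrightarrow> j \<in> C \<union> I \<Longrightarrow> E i j \<longleftrightarrow> i \<noteq> j"
    and EI: "\<And>i j. i \<in> I \<Longrightarrow> j \<in> I \<Longrightarrow> \<not> E i j"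
    and EO: "\<And>i j. i < n \<Longrightarrow> j < n \<Longrightarrow> E i j \<Longrightarrow> i \<in> C \<union> I"
    and sym: "symp E"
    and ev: "ev \<noteq> 0" "ev \<noteq> -1"
    and x: "\<exists>i<n. x i \<noteq> 0" "\<And>i. i < n \<Longrightarrow> nbsum n E x i = ev * x i"
  shows "ev\<^sup>2 - (of_nat (card C) - 1) * ev - of_nat (card C) * of_nat (card I) = 0"
proof -
  have fin: "finite C" "finite I" using CI finite_subset by blast+
  have lt: "i < n" if "i \<in> C \<union> I" for i using that CI by auto
  have x0: "x i = 0" if "i < n" "i \<notin> C \<union> I" for i
  proof -
    have "nbsum n E x i = 0" unfolding nbsum_def using that EO by (intro sum.neutral) auto
    then show ?thesis using x(2) that ev by simp
  qed
  define c where "c = sum x C"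
  define t where "t = sum x C + sum x I"
  have xI: "ev * x i = c" if "i \<in> I" for i
  proof -
    have "j \<in> C" if "j < n" "E i j" for j
      using EO[OF that(1) lt sympD[OF sym that(2)]] EI[OF \<open>i \<in> I\<close>, of j] that(2) \<open>i \<in> I\<close> by blast
    moreover have "E i j" if "j \<in> C" for j
      using EC[OF that, of i] that \<open>i \<in> I\<close> CI(3) by (auto intro: sympD[OF sym])
    ultimately have "{j. j < n \<and> E i j} = C" using lt by blast
    then show ?thesis using x(2)[of i] lt that by (simp add: nbsum_def c_def)
  qed
  have xC: "(ev + 1) * x i = t" if "i \<in> C" for i
  proof -
    have "j \<in> C \<union> I" if "j < n" "E i j" for j
      using EO[OF that(1) lt sympD[OF sym that(2)]] \<open>i \<in> C\<close> by blast
    then have "{j. j < n \<and> E i j} = (C \<union> I) - {i}"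
      using EC[OF that] lt by blast
    then have "nbsum n E x i = sum x (C \<union> I) - x i"
      unfolding nbsum_def using that fin by (simp add: sum_diff1)
    then show ?thesis
      using x(2)[of i] lt that fin CI(3) by (simp add: t_def sum.union_disjoint algebra_simps)
  qed
  have "ev * sum x I = (\<Sum>i\<in>I. ev * x i)" by (rule sum_distrib_left)
  also have "\<dots> = of_nat (card I) * c" using xI by simp
  finally have I: "ev * sum x I = of_nat (card I) * c" .
  have "(ev + 1) * c = (\<Sum>i\<in>C. (ev + 1) * x i)" unfolding c_def by (rule sum_distrib_left)
  also have "\<dots> = of_nat (card C) * t" using xC by simp
  finally have C: "(ev + 1) * c = of_nat (card C) * t" .
  have ev1: "ev + 1 \<noteq> 0" using ev(2) by (simp add: add_eq_0_iff2)
  \<comment> \<open>If the sum over \<open>C\<close> vanished, so would the sum over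
    \<open>I\<close>, and then all of \<open>x\<close>.\<close>
  have "c \<noteq> 0"
  proof
    assume c0: "c = 0"
    then have "sum x I = 0" using I ev(1) by simp
    then have "t = 0" using c0 by (simp add: t_def c_def)
    then have "x i = 0" if "i \<in> C \<union> I" for i using that xI xC c0 ev(1) ev1 by fastforce
    then show False using x(1) x0 by blast
  qed
  moreover have "c * (ev\<^sup>2 - (of_nat (card C) - 1) * ev - of_nat (card C) * of_nat (card I)) = 0"
  proof -
    have "t = c + sum x I" by (simp add: t_def c_def)
    then have "ev * t = ev * c + of_nat (card I) * c" unfolding I[symmetric] by (simp only: distrib_left)
    moreover have "ev * ((ev + 1) * c) = of_nat (card C) * (ev * t)" unfolding C by simp
    ultimately show ?thesis by (simp add: algebra_simps power2_eq_square)
  qed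
  ultimately show ?thesis by simp
qed

text \<open>If \<open>n - k \<ge> 2\<close>, both roots of the quadratic of the pyramid graph differ
  from 0 and -1, so two monic quadratics share two distinct roots and coincide. If
  \<open>n = Suc k\<close>, the pyramid graph is complete and -1 is a root; only the root
  \<open>k\<close> remains, and \<open>c + m \<le> n\<close> makes up for the lost equation.\<close>

lemma complete_split_parameters:
  fixes k n c m :: nat
  assumes k: "1 < k" "k < n" and m: "m \<ge> 1" "c + m \<le> n"
    and eq: "\<And>ev::real. ev\<^sup>2 - (real k - 1) * ev - real k * (real n - real k) = 0 \<Longrightarrow> ev \<noteq> 0 \<Longrightarrow> ev \<noteq> -1 \<Longrightarrow>
      ev\<^sup>2 - (real c - 1) * ev - real c * real m = 0"
  shows "c = k \<and> m = n - k"
proof (cases "n = Suc k")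
  case True
  have "(real k)\<^sup>2 - (real c - 1) * real k - real c * real m = 0"
    using k True by (intro eq) (auto simp: power2_eq_square algebra_simps)
  then have e: "real k * (real k + 1 - real c) = real c * real m"
    by (simp add: algebra_simps power2_eq_square)
  have m': "real m \<le> real k + 1 - real c" "real m \<ge> 1" using m True by linarith+
  have "real c * real m \<le> real c * (real k + 1 - real c)" using m' by (intro mult_left_mono) auto
  \<comment> \<open>Together with \<open>c < k + 1\<close>, which holds because
    \<open>m \<ge> 1\<close>, this leaves only \<open>c = k\<close>.\<close>
  then have "(real k - real c) * (real k + 1 - real c) \<le> 0" using e by (simp add: algebra_simps)
  moreover have "real k + 1 - real c > 0" using m' by linarith
  ultimately have "real k \<le> real c" by (simp add: mult_le_0_iff)
  moreover have "real c \<le> real k" using m' by linarith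
  ultimately have "c = k" by simp
  then show ?thesis using e k True by simp
next
  case False
  define D where "D = (real k - 1)\<^sup>2 + 4 * (real k * (real n - real k))"
  have kn: "real n - real k \<ge> 2" "real k \<ge> 2" using k False by linarith+
  have D: "D > 0" unfolding D_def using kn by (intro add_nonneg_pos) auto
  define p q where "p = (real k - 1 + sqrt D) / 2" and "q = (real k - 1 - sqrt D) / 2"
  have root: "ev\<^sup>2 - (real k - 1) * ev - real k * (real n - real k) = 0"
    if "ev = (real k - 1 + r) / 2" "r\<^sup>2 = D" for ev r
  proof -
    have "4 * (ev\<^sup>2 - (real k - 1) * ev - real k * (real n - real k)) = r\<^sup>2 - D"
      unfolding D_def that(1) by (simp add: field_simps power2_eq_square)
    then show ?thesis using that(2) by simp
  qed
  have rp: "p\<^sup>2 - (real k - 1) * p - real k * (real n - real k) = 0"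
    using D by (intro root[of p "sqrt D"]) (auto simp: p_def)
  have rq: "q\<^sup>2 - (real k - 1) * q - real k * (real n - real k) = 0"
    using D by (intro root[of q "- sqrt D"]) (auto simp: q_def)
  \<comment> \<open>At -1 the quadratic takes the value \<open>k * (1 - (n - k))\<close>, nonzero
    because \<open>n - k \<ge> 2\<close>.\<close>
  have ne: "ev \<noteq> 0 \<and> ev \<noteq> -1"
    if "ev\<^sup>2 - (real k - 1) * ev - real k * (real n - real k) = 0" for ev
  proof (intro conjI notI)
    assume "ev = 0"
    then show False using that kn by simp
  next
    assume "ev = -1"
    then have "real k * (1 - (real n - real k)) = 0" using that by (simp add: algebra_simps)
    then show False using kn by simp
  qed
  have eq': "ev * (real c - real k) = real k * (real n - real k) - real c * real m"
    if "ev\<^sup>2 - (real k - 1) * ev - real k * (real n - real k) = 0" for ev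
    using eq[OF that] ne[OF that] that by (simp add: algebra_simps)
  have "p * (real c - real k) = q * (real c - real k)" using eq'[OF rp] eq'[OF rq] by simp
  moreover have "p \<noteq> q" using D by (simp add: p_def q_def)
  ultimately have c: "c = k" by simp
  then have "real k * (real n - real k) = real k * real m" using eq'[OF rp] by simp
  then have "real n - real k = real m" using kn by simp
  then show ?thesis using c by linarith
qed

section \<open>Spectral properties of the pyramid graph\<close>

text \<open>The adjacency of $T_{n,k}$ on the vertices below \<open>n\<close>, with the clique
  placed first.\<close>

definition split_rel :: "nat \<Rightarrow> nat \<Rightarrow> nat \<Rightarrow> bool" where
  "split_rel k i j \<longleftrightarrow> i \<noteq> j \<and> (i < k \<or> j < k)"

lemma symp_split_rel: "symp (split_rel k)"
  by (auto simp: split_rel_def intro: sympI)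

lemma nbsum_split_rel:
  assumes "k \<le> n" "i < n"
  shows "nbsum n (split_rel k) x i = (if i < k then (\<Sum>j<n. x j) - x i else (\<Sum>j<k. x j))"
proof (cases "i < k")
  case True
  then have "{j. j < n \<and> split_rel k i j} = {..<n} - {i}" by (auto simp: split_rel_def)
  then show ?thesis using assms True by (simp add: nbsum_def sum_diff1)
next
  case False
  then have "{j. j < n \<and> split_rel k i j} = {..<k}" using assms by (auto simp: split_rel_def)
  then show ?thesis using False by (simp add: nbsum_def)
qed

text \<open>The matrix consists of all-ones blocks minus the identity on the clique, so the form
  depends only on partial sums and squared moduli.\<close>

lemma hform_split_rel:
  assumes "k \<le> n"
  shows "hform s c n (split_rel k) x
    = s * (Re (cnj (\<Sum>j<k. x j) * (\<Sum>j<n. x j) + cnj (\<Sum>j=k..<n. x j) * (\<Sum>j<k. x j))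
        - (\<Sum>i<k. (cmod (x i))\<^sup>2) - c * (\<Sum>i<n. (cmod (x i))\<^sup>2))"
proof -
  have split: "{..<n} = {..<k} \<union> {k..<n}" using assms by auto
  have "(\<Sum>i<n. cnj (x i) * nbsum n (split_rel k) x i)
      = (\<Sum>i<k. cnj (x i) * nbsum n (split_rel k) x i) + (\<Sum>i=k..<n. cnj (x i) * nbsum n (split_rel k) x i)"
    unfolding split by (rule sum.union_disjoint) auto
  also have "(\<Sum>i<k. cnj (x i) * nbsum n (split_rel k) x i) = (\<Sum>i<k. cnj (x i) * (\<Sum>j<n. x j) - cnj (x i) * x i)"
    using assms by (intro sum.cong refl) (simp add: nbsum_split_rel algebra_simps)
  also have "\<dots> = cnj (\<Sum>j<k. x j) * (\<Sum>j<n. x j) - of_real (\<Sum>i<k. (cmod (x i))\<^sup>2)"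
    unfolding sum_subtractf sum_distrib_right[symmetric] cnj_sum
    by (simp only: of_real_sum complex_norm_square mult.commute)
  also have "(\<Sum>i=k..<n. cnj (x i) * nbsum n (split_rel k) x i) = (\<Sum>i=k..<n. cnj (x i) * (\<Sum>j<k. x j))"
    using assms by (intro sum.cong refl) (simp add: nbsum_split_rel)
  also have "\<dots> = cnj (\<Sum>j=k..<n. x j) * (\<Sum>j<k. x j)"
    by (simp add: sum_distrib_right)
  finally show ?thesis by (simp add: hform_def)
qed

text \<open>Every plane meets the hyperplane of vectors with sum zero over \<open>J\<close> in more
  than the origin.\<close>

lemma inertia_le_oneI:
  assumes "\<And>z. sum z J = 0 \<Longrightarrow> hform s c n E z \<le> 0"
  shows "inertia_le_one s c n E"
  unfolding inertia_le_one_def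
proof (intro allI)
  fix x y :: "nat \<Rightarrow> complex"
  obtain a b where ab: "a \<noteq> 0 \<or> b \<noteq> 0" "a * sum x J + b * sum y J = 0"
  proof (cases "sum x J = 0 \<and> sum y J = 0")
    case True
    then show ?thesis using that[of 1 0] by simp
  next
    case False
    then show ?thesis using that[of "sum y J" "- sum x J"] by auto
  qed
  have "sum (\<lambda>i. a * x i + b * y i) J = 0"
    using ab(2) by (simp add: sum.distrib sum_distrib_left)
  then show "\<exists>\<alpha> \<beta>. (\<alpha> \<noteq> 0 \<or> \<beta> \<noteq> 0) \<and> hform s c n E (\<lambda>i. \<alpha> * x i + \<beta> * y i) \<le> 0"
    using ab(1) assms by blast
qed

lemma sum_split_lessThan:
  fixes x :: "nat \<Rightarrow> 'b::comm_monoid_add"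
  assumes "k \<le> n"
  shows "(\<Sum>j<n. x j) = (\<Sum>j<k. x j) + (\<Sum>j=k..<n. x j)"
proof -
  have split: "{..<n} = {..<k} \<union> {k..<n}" using assms by auto
  show ?thesis unfolding split by (rule sum.union_disjoint) auto
qed

text \<open>On a suitable hyperplane the form is minus a sum of squares: total sum zero for the
  threshold 0, sum zero over the independent part for the threshold -1.\<close>

lemma inertia_split_rel:
  assumes "k \<le> n"
  shows "inertia_le_one 1 0 n (split_rel k)" and "inertia_le_one (-1) (-1) n (split_rel k)"
proof -
  show "inertia_le_one 1 0 n (split_rel k)"
  proof (rule inertia_le_oneI[of "{..<n}"])
    fix z :: "nat \<Rightarrow> complex" assume z: "sum z {..<n} = 0"
    then have z': "(\<Sum>j=k..<n. z j) = - (\<Sum>j<k. z j)"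
      using sum_split_lessThan[OF assms, of z] by (simp add: eq_neg_iff_add_eq_0 add.commute)
    have "Re (cnj u * 0 + cnj (- u) * u) = - (cmod u)\<^sup>2" for u
      unfolding cmod_power2 by (simp add: power2_eq_square)
    then have "hform 1 0 n (split_rel k) z = - (cmod (\<Sum>j<k. z j))\<^sup>2 - (\<Sum>i<k. (cmod (z i))\<^sup>2)"
      unfolding hform_split_rel[OF assms] z z' by (simp only:) simp
    moreover have "(\<Sum>i<k. (cmod (z i))\<^sup>2) \<ge> 0" by (intro sum_nonneg) auto
    ultimately show "hform 1 0 n (split_rel k) z \<le> 0"
      using zero_le_power2[of "cmod (\<Sum>j<k. z j)"] by linarith
  qed
  show "inertia_le_one (-1) (-1) n (split_rel k)"
  proof (rule inertia_le_oneI[of "{k..<n}"])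
    fix z :: "nat \<Rightarrow> complex" assume z: "sum z {k..<n} = 0"
    have "Re (cnj u * (u + 0) + cnj 0 * u) = (cmod u)\<^sup>2" for u
      unfolding cmod_power2 by (simp add: power2_eq_square)
    then have "hform (-1) (-1) n (split_rel k) z = - (cmod (\<Sum>j<k. z j))\<^sup>2 - (\<Sum>i=k..<n. (cmod (z i))\<^sup>2)"
      unfolding hform_split_rel[OF assms] sum_split_lessThan[OF assms] z by (simp only:) simp
    moreover have "(\<Sum>i=k..<n. (cmod (z i))\<^sup>2) \<ge> 0" by (intro sum_nonneg) auto
    ultimately show "hform (-1) (-1) n (split_rel k) z \<le> 0"
      using zero_le_power2[of "cmod (\<Sum>j<k. z j)"] by linarith
  qed
qed

lemma minus_one_eigenvalue_split_rel:
  assumes "1 < k" "k \<le> n"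
  shows "poly (char_poly (adj_mat n (split_rel k))) (- 1) = 0"
  unfolding root_char_poly_adj_mat
proof (intro exI conjI allI impI)
  \<comment> \<open>The difference of two clique vertices; \<open>1 < k\<close> puts both 0 and 1
    into the clique.\<close>
  let ?x = "\<lambda>i::nat. if i = 0 then 1 else if i = 1 then -1 else (0::complex)"
  have "(\<Sum>j<m. ?x j) = 0" if m: "1 < m" for m
  proof -
    have "(\<Sum>j<m. ?x j) = (\<Sum>j\<in>{0, 1}. ?x j)" using m by (intro sum.mono_neutral_right) auto
    then show ?thesis by simp
  qed
  then show "nbsum n (split_rel k) ?x i = - 1 * ?x i" if "i < n" for i
    using assms that by (simp add: nbsum_split_rel)
  show "0 < n" "?x 0 \<noteq> 0" using assms by auto
qed

lemma quadratic_eigenvalue_split_rel: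
  assumes "0 < k" "k < n"
    and ev: "ev\<^sup>2 - (real k - 1) * ev - real k * (real n - real k) = 0"
  shows "poly (char_poly (adj_mat n (split_rel k))) (of_real ev) = 0"
proof -
  have kn: "k \<le> n" using assms by simp
  \<comment> \<open>An eigenvector constant on both parts: the equation on the independent part
    fixes the ratio of the values \<open>ev\<close> and \<open>k\<close>, and the one on the clique
    is the quadratic.\<close>
  let ?x = "\<lambda>i. if i < k then complex_of_real ev else of_nat k"
  have C: "(\<Sum>j<k. ?x j) = of_nat k * of_real ev" by simp
  have I: "(\<Sum>j=k..<n. ?x j) = of_nat (n - k) * of_nat k" by simp
  have "ev * ev = (real k * ev + real (n - k) * real k) - ev"
    using ev assms by (simp add: algebra_simps power2_eq_square of_nat_diff)
  then have "complex_of_real (ev * ev) = of_real ((real k * ev + real (n - k) * real k) - ev)"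
    by (rule arg_cong)
  then have e: "complex_of_real ev * of_real ev = of_nat k * of_real ev + of_nat (n - k) * of_nat k - of_real ev"
    unfolding of_real_mult of_real_add of_real_diff of_real_of_nat_eq .
  have ev: "nbsum n (split_rel k) ?x i = of_real ev * ?x i" if "i < n" for i
    unfolding nbsum_split_rel[OF kn that] sum_split_lessThan[OF kn] C I using e by simp
  \<comment> \<open>The last vertex lies in the independent part, where the value is
    \<open>k\<close>, so the vector is nonzero even if \<open>ev\<close> is 0.\<close>
  have nz: "n - 1 < n" "?x (n - 1) \<noteq> 0" using assms by auto
  show ?thesis
    unfolding root_char_poly_adj_mat
    by (intro exI[of _ ?x] conjI exI[of _ "n - 1"] allI impI) (fact nz ev)+
qed

section \<open>Cospectral graphs\<close>

text \<open>Both inertia bounds, the eigenvalue -1 and the roots of the quadratic pass to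
  \<open>E\<close>. The first three give the split structure, the last its parameters.\<close>

lemma cospectral_split_rel:
  assumes k: "1 < k" "k < n" and sym: "symp E" and irr: "irreflp E"
    and eq: "proots (char_poly (adj_mat n E)) = proots (char_poly (adj_mat n (split_rel k)))"
  obtains C where "C \<subseteq> {..<n}" "card C = k"
    "\<And>i j. i < n \<Longrightarrow> j < n \<Longrightarrow> E i j \<longleftrightarrow> i \<noteq> j \<and> (i \<in> C \<or> j \<in> C)"
proof -
  have kn: "k \<le> n" using k by simp
  have nz: "char_poly (adj_mat n R) \<noteq> 0" for R
    using degree_monic_char_poly[OF adj_mat_carrier, of n R] by auto
  have root: "poly (char_poly (adj_mat n E)) ev = 0"
    if "poly (char_poly (adj_mat n (split_rel k))) ev = 0" for ev
    using arg_cong[OF eq, of set_mset] that nz by (auto simp: set_count_proots)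
  note inert = inertia_le_one_cospectral[OF sym symp_split_rel eq inertia_split_rel(1)[OF kn]]
    inertia_le_one_cospectral[OF sym symp_split_rel eq inertia_split_rel(2)[OF kn]]
  obtain x where x: "\<exists>i<n. x i \<noteq> 0" "\<And>i. i < n \<Longrightarrow> nbsum n E x i = - 1 * x i"
    using root[OF minus_one_eigenvalue_split_rel[OF k(1) kn]] unfolding root_char_poly_adj_mat by blast
  then have x': "\<And>i. i < n \<Longrightarrow> nbsum n E x i = - x i" by simp
  obtain C I where CI: "C \<subseteq> {..<n}" "I \<subseteq> {..<n}" "C \<inter> I = {}" "I \<noteq> {}"
    and EC: "\<And>i j. i \<in> C \<Longrightarrow> j \<in> C \<union> I \<Longrightarrow> E i j \<longleftrightarrow> i \<noteq> j"
    and EI: "\<And>i j. i \<in> I \<Longrightarrow> j \<in> I \<Longrightarrow> \<not> E i j"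
    and EO: "\<And>i j. i < n \<Longrightarrow> j < n \<Longrightarrow> E i j \<Longrightarrow> i \<in> C \<union> I"
    by (rule complete_split_structure[OF sym irr inert x(1) x']) blast+
  have fin: "finite C" "finite I" using CI finite_subset by blast+
  have cardCI: "card (C \<union> I) = card C + card I" using fin CI(3) by (rule card_Un_disjoint)
  have "card C = k \<and> card I = n - k"
  proof (rule complete_split_parameters[OF k])
    show "card I \<ge> 1" using fin CI(4) by (simp add: Suc_le_eq card_gt_0_iff)
    have "card (C \<union> I) \<le> card {..<n}" using CI by (intro card_mono) auto
    then show "card C + card I \<le> n" unfolding cardCI by simp
    fix ev :: real
    assume ev: "ev\<^sup>2 - (real k - 1) * ev - real k * (real n - real k) = 0" "ev \<noteq> 0" "ev \<noteq> -1"
    have k0: "0 < k" using k by simp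
    obtain y where y: "\<exists>i<n. y i \<noteq> 0" "\<And>i. i < n \<Longrightarrow> nbsum n E y i = of_real ev * y i"
      using root[OF quadratic_eigenvalue_split_rel[OF k0 k(2) ev(1)]] unfolding root_char_poly_adj_mat by blast
    have ev': "complex_of_real ev \<noteq> 0" "complex_of_real ev \<noteq> -1"
      using ev(2,3) by (auto simp: complex_eq_iff)
    have "(complex_of_real ev)\<^sup>2 - (of_nat (card C) - 1) * of_real ev - of_nat (card C) * of_nat (card I) = 0"
      by (rule complete_split_eigenvalue[OF CI(1-3) _ _ _ sym ev' y(1)]) (fact EC, fact EI, fact EO, fact y(2))
    then have "complex_of_real (ev\<^sup>2 - (real (card C) - 1) * ev - real (card C) * real (card I)) = of_real 0"
      by simp
    then show "ev\<^sup>2 - (real (card C) - 1) * ev - real (card C) * real (card I) = 0"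
      by (simp only: of_real_eq_iff)
  qed
  then have cards: "card C = k" "card (C \<union> I) = n" using k cardCI by auto
  \<comment> \<open>The sizes \<open>k\<close> and \<open>n - k\<close> exhaust the vertices, so
    none is isolated.\<close>
  have "C \<union> I = {..<n}" using CI cards(2) by (intro card_subset_eq) auto
  then have all: "i \<in> C \<or> i \<in> I" if "i < n" for i using that by blast
  have "E i j \<longleftrightarrow> i \<noteq> j \<and> (i \<in> C \<or> j \<in> C)" if ij: "i < n" "j < n" for i j
  proof (cases "i \<in> C")
    case True
    then show ?thesis using EC[of i j] all[OF ij(2)] by blast
  next
    case False
    then have i: "i \<in> I" using all ij by blast
    show ?thesis
    proof (cases "j \<in> C")
      case True
      then show ?thesis using EC[of j i] i sym by (metis UnCI sympD)
    next
      case False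
      then show ?thesis using EI[OF i] all ij \<open>i \<notin> C\<close> by blast
    qed
  qed
  then show ?thesis using that CI(1) cards(1) by blast
qed

section \<open>From adjacency relations on indices to graph isomorphism\<close>

lemma adjacency_matrix_adj_mat:
  "adjacency_matrix G vs = adj_mat (length vs) (\<lambda>i j. (vs ! i, vs ! j) \<in> arcs_ends G)"
  by (simp add: adjacency_matrix_def adj_mat_def)

lemma adjacency_spectrum_pyramid_graph:
  assumes "k \<le> n"
  shows "adjacency_spectrum (with_proj (pyramid_graph n k)) = proots (char_poly (adj_mat n (split_rel k)))"
proof -
  \<comment> \<open>Listing the clique before the independent part makes the adjacency matrix
    literally that of \<open>split_rel k\<close>.\<close>
  define vs :: "(nat + nat) list" where "vs = map Inl [0..<k] @ map Inr [0..<n - k]"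
  have len: "length vs = n" using assms by (simp add: vs_def)
  have enum: "vertex_enum (with_proj (pyramid_graph n k)) vs"
    by (auto simp: vertex_enum_def vs_def distinct_map pyramid_graph_def graph_join_def complete_graph_def
        empty_graph_def inj_on_def)
  have nth: "vs ! i = (if i < k then Inl i else Inr (i - k))" if "i < n" for i
    using that assms by (auto simp: vs_def nth_append)
  have "(vs ! i, vs ! j) \<in> arcs_ends (with_proj (pyramid_graph n k)) \<longleftrightarrow> split_rel k i j"
    if "i < n" "j < n" for i j
    unfolding nth[OF that(1)] nth[OF that(2)] using that assms
    by (auto simp: arcs_ends_def arc_to_ends_def split_rel_def pyramid_graph_def graph_join_def
        complete_graph_def empty_graph_def image_iff)
  then have "adjacency_matrix (with_proj (pyramid_graph n k)) vs = adj_mat n (split_rel k)"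
    unfolding adjacency_matrix_adj_mat len by (intro eq_matI) (auto simp: adj_mat_def)
  then show ?thesis using adjacency_spectrum_eq[OF enum] by simp
qed

text \<open>Arcs of \<open>G\<close> are abstract, whereas those of \<open>with_proj H\<close> are
  pairs. Each arc goes to the pair of images of its ends, which is injective because there are no
  parallel arcs.\<close>

lemma digraph_iso_with_projI:
  assumes "nomulti_digraph G" and bij: "bij_betw f (verts G) (pverts H)"
    and arcs: "\<And>u v. u \<in> verts G \<Longrightarrow> v \<in> verts G \<Longrightarrow> (u, v) \<in> arcs_ends G \<longleftrightarrow> (f u, f v) \<in> parcs H"
    and H: "parcs H \<subseteq> pverts H \<times> pverts H"
  shows "digraph_iso G (with_proj H)"
proof -
  interpret nomulti_digraph G by fact
  define h where "h = \<lparr>iso_verts = f, iso_arcs = (\<lambda>a. (f (tail G a), f (head G a))),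
    iso_head = snd, iso_tail = fst\<rparr>"
  have inj: "inj_on f (verts G)" using bij by (rule bij_betw_imp_inj_on)
  have "inj_on (iso_arcs h) (arcs G)"
  proof (rule inj_onI)
    fix a b assume ab: "a \<in> arcs G" "b \<in> arcs G" "iso_arcs h a = iso_arcs h b"
    then have "f (tail G a) = f (tail G b)" "f (head G a) = f (head G b)" by (auto simp: h_def)
    then have "tail G a = tail G b" "head G a = head G b"
      using inj ab(1,2) by (auto dest: inj_onD)
    then show "a = b" using no_multi_arcs[OF ab(1,2)] by (simp add: arc_to_ends_def)
  qed
  then have iso: "digraph_isomorphism h"
    unfolding digraph_isomorphism_def using inj wf_digraph_axioms by (auto simp: h_def)
  have "(\<lambda>a. (f (tail G a), f (head G a))) ` arcs G = parcs H"
  proof (intro Set.set_eqI iffI)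
    fix e assume "e \<in> (\<lambda>a. (f (tail G a), f (head G a))) ` arcs G"
    then obtain a where a: "a \<in> arcs G" "e = (f (tail G a), f (head G a))" by blast
    then have "(tail G a, head G a) \<in> arcs_ends G" by (auto simp: arcs_ends_def arc_to_ends_def)
    then show "e \<in> parcs H" using arcs a by auto
  next
    fix e assume e: "e \<in> parcs H"
    then have "fst e \<in> f ` verts G" "snd e \<in> f ` verts G"
      using H bij unfolding bij_betw_def by auto
    then obtain u v where uv: "u \<in> verts G" "v \<in> verts G" "e = (f u, f v)"
      by (metis imageE prod.collapse)
    then have "(u, v) \<in> arcs_ends G" using arcs e by auto
    then show "e \<in> (\<lambda>a. (f (tail G a), f (head G a))) ` arcs G"
      using uv(3) by (auto simp: arcs_ends_def arc_to_ends_def)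
  qed
  then have "with_proj H = app_iso h G"
    using bij by (simp add: app_iso_def h_def with_proj_def bij_betw_def)
  with iso show ?thesis unfolding digraph_iso_def by blast
qed

theorem theorem3p4p4:
  fixes n k :: nat
    and G :: "('a, 'b) pre_digraph"
  assumes "1 < k" and "k < n"
    and "graph G"
    and "adjacency_spectrum G = adjacency_spectrum (with_proj (pyramid_graph n k))"
  shows "digraph_iso G (with_proj (pyramid_graph n k))"
proof -
  interpret graph G by fact
  obtain vs where vs: "distinct vs" "set vs = verts G"
    using finite_distinct_list[OF finite_verts] by blast
  define E where "E = (\<lambda>i j. (vs ! i, vs ! j) \<in> arcs_ends G)"
  have spec: "proots (char_poly (adj_mat (length vs) E)) = proots (char_poly (adj_mat n (split_rel k)))"
    using assms(2,4) adjacency_spectrum_eq[of G vs] vs adjacency_spectrum_pyramid_graph[of k n]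
    by (simp add: vertex_enum_def adjacency_matrix_adj_mat E_def)
  \<comment> \<open>The size of the spectrum is the degree of the characteristic polynomial, hence
    the number of vertices.\<close>
  have "degree (char_poly (adj_mat m R)) = m" for m R
    using degree_monic_char_poly[OF adj_mat_carrier, of m R] by blast
  then have len: "length vs = n"
    using arg_cong[OF spec, of size] by (simp add: size_proots_complex)
  have sym: "symp E"
    using sym_arcs by (auto simp: E_def symmetric_def intro!: sympI dest: symD)
  have irr: "irreflp E"
    by (auto simp: E_def intro!: irreflpI dest: adj_not_same)
  obtain C where C: "C \<subseteq> {..<n}" "card C = k"
    and EC: "\<And>i j. i < n \<Longrightarrow> j < n \<Longrightarrow> E i j \<longleftrightarrow> i \<noteq> j \<and> (i \<in> C \<or> j \<in> C)"
    by (rule cospectral_split_rel[OF assms(1,2) sym irr spec[unfolded len]]) blast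
  have nth: "bij_betw ((!) vs) {..<n} (verts G)"
    using bij_betw_nth[OF vs(1), of "{..<n}" "verts G"] vs(2) len by simp
  define D where "D = (!) vs ` C"
  have DV: "D \<subseteq> verts G" unfolding D_def using bij_betw_imp_surj_on[OF nth] C(1) by blast
  have finD: "finite D" using DV finite_verts finite_subset by blast
  have cD: "card D = k"
    unfolding D_def using C bij_betw_imp_inj_on[OF nth] by (metis card_image inj_on_subset)
  have cV: "card (verts G - D) = n - k"
    using cD DV finD vs len by (metis card_Diff_subset distinct_card)
  obtain g where g: "bij_betw g D {..<k}"
    using finite_same_card_bij[OF finD, of "{..<k}"] cD by auto
  obtain h where h: "bij_betw h (verts G - D) {..<n - k}"
    using finite_same_card_bij[of "verts G - D" "{..<n - k}"] cV finite_verts by auto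
  \<comment> \<open>Any bijections \<open>g\<close> and \<open>h\<close> between the corresponding
    parts will do, since adjacency of distinct vertices depends only on membership in
    \<open>D\<close>.\<close>
  define f where "f v = (if v \<in> D then Inl (g v) else Inr (h v))" for v
  have adj: "(u, v) \<in> arcs_ends G \<longleftrightarrow> u \<noteq> v \<and> (u \<in> D \<or> v \<in> D)" if uv: "u \<in> verts G" "v \<in> verts G" for u v
  proof -
    obtain i j where ij: "i < n" "u = vs ! i" "j < n" "v = vs ! j"
      using uv vs(2) len by (metis in_set_conv_nth)
    have "vs ! l \<in> D \<longleftrightarrow> l \<in> C" if "l < n" for l
      unfolding D_def using inj_on_image_mem_iff[OF bij_betw_imp_inj_on[OF nth], of l C] that C(1) by simp
    moreover have "u \<noteq> v \<longleftrightarrow> i \<noteq> j" using ij vs(1) len by (simp add: nth_eq_iff_index_eq)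
    ultimately show ?thesis using EC[OF ij(1,3)] ij by (simp add: E_def)
  qed
  show ?thesis
  proof (rule digraph_iso_with_projI)
    show "nomulti_digraph G" by unfold_locales
    show "bij_betw f (verts G) (pverts (pyramid_graph n k))"
      unfolding bij_betw_def
    proof
      show "inj_on f (verts G)"
        using g h by (auto simp: inj_on_def f_def bij_betw_def)
      have "f ` verts G = f ` D \<union> f ` (verts G - D)" using DV by blast
      also have "\<dots> = Inl ` g ` D \<union> Inr ` h ` (verts G - D)" by (auto simp: f_def)
      also have "\<dots> = Inl ` {..<k} \<union> Inr ` {..<n - k}" using g h by (simp add: bij_betw_def)
      finally show "f ` verts G = pverts (pyramid_graph n k)"
        by (auto simp: pyramid_graph_def graph_join_def complete_graph_def empty_graph_def)
    qed
    show "parcs (pyramid_graph n k) \<subseteq> pverts (pyramid_graph n k) \<times> pverts (pyramid_graph n k)"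
      by (auto simp: pyramid_graph_def graph_join_def complete_graph_def empty_graph_def)
    fix u v assume uv: "u \<in> verts G" "v \<in> verts G"
    have gD: "g w < k" if "w \<in> D" for w using g that by (auto simp: bij_betw_def)
    have hD: "h w < n - k" if "w \<in> verts G" "w \<notin> D" for w using h that by (auto simp: bij_betw_def)
    have "g u = g v \<longleftrightarrow> u = v" if "u \<in> D" "v \<in> D"
      using bij_betw_imp_inj_on[OF g] that by (auto dest: inj_onD)
    then show "(u, v) \<in> arcs_ends G \<longleftrightarrow> (f u, f v) \<in> parcs (pyramid_graph n k)"
      unfolding adj[OF uv] f_def using gD hD uv
      by (auto simp: pyramid_graph_def graph_join_def complete_graph_def empty_graph_def image_iff)
  qed
qed

end
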